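(* Let $\mathcal{E}$ be a unital qubit channel in diagonal (Pauli) form with diagonal entries $(1,\lambda_1,\lambda_2,\lambda_3)$. Then $\mathcal{E}$ is 2-LEA if and only if the channel $\mathcal{E}^2=\mathcal{E}\circ\mathcal{E}$ is entanglement-breaking, i.e. if and only if $\lambda_1^2+\lambda_2^2+\lambda_3^2\le1$.
   Context: A qubit channel is a completely positive trace-preserving linear map on $M_2(\mathbb{C})$; it is unital if it fixes the identity $I$. A unital qubit channel $\mathcal{E}$ is in diagonal (Pauli) form with diagonal entries $(1,\lambda_1,\lambda_2,\lambda_3)$ if there is a basis $\{\sigma_0=I,\sigma_1,\sigma_2,\sigma_3\}$ of self-adjoint operators on $\mathbb{C}^2$ with $\mathrm{tr}[\sigma_j\sigma_k]=2\delta_{jk}$ such that $\mathcal{E}[I]=I$ and $\mathcal{E}[\sigma_m]=\lambda_m\sigma_m$ for $m=1,2,3$, with real (possibly negative) $\lambda_m$. A state is a positive semidefinite operator of trace one. A two-qubit channel is called entanglement-annihilating (EA) if it maps every state on $\mathbb{C}^2\otimes\mathbb{C}^2$ to a state that is separable with respect to the partition qubit 1 | qubit 2. A qubit channel $\mathcal{E}$ is called 2-locally entanglement-annihilating (2-LEA) if $\mathcal{E}\otimes\mathcal{E}$ is EA. A channel $\mathcal{F}$ is called entanglement-breaking (EB) if for every finite-dimensional ancilla and every state $\rho$ of system plus ancilla, $(\mathcal{F}\otimes\mathcal{I}_{\rm anc})[\rho]$ is separable with respect to the partition system | ancilla, where $\mathcal{I}_{\rm anc}$ is the identity channel on the ancilla.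 *)

theory Defs
  imports "Jordan_Normal_Form.Schur_Decomposition"
begin

definition mat_trace :: "complex mat \<Rightarrow> complex" where
  "mat_trace A = (\<Sum>i<dim_row A. A $$ (i, i))"

definition self_adjoint :: "nat \<Rightarrow> complex mat \<Rightarrow> bool" where
  "self_adjoint n A \<longleftrightarrow> A \<in> carrier_mat n n \<and> mat_adjoint A = A"

definition pos_semidef :: "nat \<Rightarrow> complex mat \<Rightarrow> bool" where
  "pos_semidef n A \<longleftrightarrow>
     self_adjoint n A \<and> (\<forall>v \<in> carrier_vec n. 0 \<le> Re ((A *\<^sub>v v) \<bullet>c v))"

definition is_state :: "nat \<Rightarrow> complex mat \<Rightarrow> bool" where
  "is_state n \<rho> \<longleftrightarrow> pos_semidef n \<rho> \<and> mat_trace \<rho> = 1"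

(* Finite sum of n x n matrices; the type of matrices carries no zero, as dimensions vary. *)
definition msum :: "nat \<Rightarrow> ('i \<Rightarrow> complex mat) \<Rightarrow> 'i set \<Rightarrow> complex mat" where
  "msum n f S = mat n n (\<lambda>(a, b). \<Sum>s\<in>S. f s $$ (a, b))"

(* The basis vector e_i \<otimes> e_k of C^n \<otimes> C^m has index i * m + k. *)
definition mat_tensor :: "complex mat \<Rightarrow> complex mat \<Rightarrow> complex mat" where
  "mat_tensor A B =
     mat (dim_row A * dim_row B) (dim_col A * dim_col B)
       (\<lambda>(i, j). A $$ (i div dim_row B, j div dim_col B) * B $$ (i mod dim_row B, j mod dim_col B))"

definition mat_unit :: "nat \<Rightarrow> nat \<Rightarrow> nat \<Rightarrow> complex mat" where
  "mat_unit n i j = mat n n (\<lambda>(a, b). if a = i \<and> b = j then 1 else 0)"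

(* The linear extension of A \<otimes> B \<mapsto> F A \<otimes> G B to M_{nm}, for linear maps F on M_n and G on M_m:
   X is expanded in the matrix units e_{ij} \<otimes> e_{kl}. *)
definition map_tensor ::
  "nat \<Rightarrow> nat \<Rightarrow> (complex mat \<Rightarrow> complex mat) \<Rightarrow> (complex mat \<Rightarrow> complex mat) \<Rightarrow> complex mat \<Rightarrow> complex mat"
where
  "map_tensor n m F G X =
     msum (n * m)
       (\<lambda>(i, j, k, l). X $$ (i * m + k, j * m + l) \<cdot>\<^sub>m mat_tensor (F (mat_unit n i j)) (G (mat_unit m k l)))
       ({..<n} \<times> {..<n} \<times> {..<m} \<times> {..<m})"

(* Maps are total functions on matrices of all sizes; only their values on n x n matrices matter. *)
definition linear_on_mats :: "nat \<Rightarrow> (complex mat \<Rightarrow> complex mat) \<Rightarrow> bool" where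
  "linear_on_mats n F \<longleftrightarrow>
     (\<forall>A \<in> carrier_mat n n. F A \<in> carrier_mat n n) \<and>
     (\<forall>A \<in> carrier_mat n n. \<forall>B \<in> carrier_mat n n. F (A + B) = F A + F B) \<and>
     (\<forall>c. \<forall>A \<in> carrier_mat n n. F (c \<cdot>\<^sub>m A) = c \<cdot>\<^sub>m F A)"

lemma linear_on_mats_expand:
  assumes F: "linear_on_mats n F" and A: "A \<in> carrier_mat n n" and ab: "a < n" "b < n"
  shows "F A $$ (a, b) = (\<Sum>i<n. \<Sum>j<n. A $$ (i, j) * F (mat_unit n i j) $$ (a, b))"
proof -
  define R where "R S = mat n n (\<lambda>p. if p \<in> S then A $$ p else 0)" for S
  have R: "R S \<in> carrier_mat n n" for S by (simp add: R_def)
  have U: "mat_unit n i j \<in> carrier_mat n n" for i j by (simp add: mat_unit_def)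
  have lin: "F X \<in> carrier_mat n n" "F (X + Y) = F X + F Y" "F (c \<cdot>\<^sub>m X) = c \<cdot>\<^sub>m F X"
    if "X \<in> carrier_mat n n" "Y \<in> carrier_mat n n" for X Y c
    using F that unfolding linear_on_mats_def by auto
  have FU: "F (mat_unit n i j) \<in> carrier_mat n n" for i j using lin(1)[OF U U] .
  have "F (R S) $$ (a, b) = (\<Sum>(i, j)\<in>S. A $$ (i, j) * F (mat_unit n i j) $$ (a, b))"
    if "finite S" "S \<subseteq> {..<n} \<times> {..<n}" for S
    using that
  proof (induction S rule: finite_induct)
    case empty
    have "R {} = 0 \<cdot>\<^sub>m R {}" by (rule eq_matI) (auto simp: R_def)
    then have "F (R {}) = 0 \<cdot>\<^sub>m F (R {})" using lin(3)[OF R R] by metis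
    moreover have "(0 \<cdot>\<^sub>m F (R {})) $$ (a, b) = 0"
      using lin(1)[OF R R] ab by (metis carrier_matD index_smult_mat(1) mult_zero_left)
    ultimately show ?case by simp
  next
    case (insert p S)
    obtain i j where p: "p = (i, j)" by force
    have "R (insert p S) = R S + A $$ (i, j) \<cdot>\<^sub>m mat_unit n i j"
      using insert.hyps by (intro eq_matI) (auto simp: R_def mat_unit_def p)
    then have "F (R (insert p S)) = F (R S) + A $$ (i, j) \<cdot>\<^sub>m F (mat_unit n i j)"
      using lin(2)[OF R smult_carrier_mat[OF U]] lin(3)[OF U U] by metis
    then have "F (R (insert p S)) $$ (a, b) = F (R S) $$ (a, b) + A $$ (i, j) * F (mat_unit n i j) $$ (a, b)"
      using FU[of i j] ab by simp
    then show ?case using insert by (simp add: p)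
  qed
  from this[of "{..<n} \<times> {..<n}"] have
    "F (R ({..<n} \<times> {..<n})) $$ (a, b) = (\<Sum>i<n. \<Sum>j<n. A $$ (i, j) * F (mat_unit n i j) $$ (a, b))"
    by (simp add: sum.cartesian_product)
  moreover have "R ({..<n} \<times> {..<n}) = A"
    using A by (intro eq_matI) (auto simp: R_def)
  ultimately show ?thesis by simp
qed

lemma map_tensor_mat_tensor:
  assumes F: "linear_on_mats n F" and G: "linear_on_mats m G"
    and A: "A \<in> carrier_mat n n" and B: "B \<in> carrier_mat m m"
  shows "map_tensor n m F G (mat_tensor A B) = mat_tensor (F A) (G B)"
proof (rule eq_matI)
  have FC: "X \<in> carrier_mat n n \<Longrightarrow> F X \<in> carrier_mat n n" for X
    using F by (auto simp: linear_on_mats_def)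
  have GC: "X \<in> carrier_mat m m \<Longrightarrow> G X \<in> carrier_mat m m" for X
    using G by (auto simp: linear_on_mats_def)
  have FU: "F (mat_unit n i j) \<in> carrier_mat n n" and GU: "G (mat_unit m i j) \<in> carrier_mat m m" for i j
    by (rule FC, simp add: mat_unit_def) (rule GC, simp add: mat_unit_def)
  note dims = carrier_matD[OF A] carrier_matD[OF B] carrier_matD[OF FU] carrier_matD[OF GU]
    carrier_matD[OF FC[OF A]] carrier_matD[OF GC[OF B]]
  show "dim_row (map_tensor n m F G (mat_tensor A B)) = dim_row (mat_tensor (F A) (G B))"
    "dim_col (map_tensor n m F G (mat_tensor A B)) = dim_col (mat_tensor (F A) (G B))"
    by (simp_all add: map_tensor_def msum_def mat_tensor_def dims)
  fix a b assume "a < dim_row (mat_tensor (F A) (G B))" "b < dim_col (mat_tensor (F A) (G B))"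
  then have ab: "a < n * m" "b < n * m" by (simp_all add: mat_tensor_def dims)
  then have m: "0 < m" by (cases m) auto
  have q: "a div m < n" "b div m < n" "a mod m < m" "b mod m < m"
    using ab m by (simp_all add: less_mult_imp_div_less)
  have idx: "i * m + k < n * m" if "i < n" "k < m" for i k
  proof -
    have "i * m + k < Suc i * m" using that by simp
    also have "\<dots> \<le> n * m" using that by (intro mult_right_mono) auto
    finally show ?thesis .
  qed
  have "map_tensor n m F G (mat_tensor A B) $$ (a, b) =
    (\<Sum>(i, j, k, l)\<in>{..<n} \<times> {..<n} \<times> {..<m} \<times> {..<m}.
       (A $$ (i, j) * F (mat_unit n i j) $$ (a div m, b div m)) *
       (B $$ (k, l) * G (mat_unit m k l) $$ (a mod m, b mod m)))"
    unfolding map_tensor_def msum_def using ab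
    by (auto simp: mat_tensor_def dims idx intro!: sum.cong)
  also have "\<dots> = (\<Sum>i<n. \<Sum>j<n. A $$ (i, j) * F (mat_unit n i j) $$ (a div m, b div m)) *
       (\<Sum>k<m. \<Sum>l<m. B $$ (k, l) * G (mat_unit m k l) $$ (a mod m, b mod m))"
    by (simp only: sum_distrib_right)
      (simp add: sum.cartesian_product[symmetric] sum_distrib_left mult_ac)
  also have "\<dots> = mat_tensor (F A) (G B) $$ (a, b)"
    using linear_on_mats_expand[OF F A q(1,2)] linear_on_mats_expand[OF G B q(3,4)] ab
    by (simp add: mat_tensor_def dims)
  finally show "map_tensor n m F G (mat_tensor A B) $$ (a, b) = mat_tensor (F A) (G B) $$ (a, b)" .
qed

definition completely_positive :: "nat \<Rightarrow> (complex mat \<Rightarrow> complex mat) \<Rightarrow> bool" where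
  "completely_positive n F \<longleftrightarrow>
     (\<forall>m A. pos_semidef (n * m) A \<longrightarrow> pos_semidef (n * m) (map_tensor n m F id A))"

definition trace_preserving :: "nat \<Rightarrow> (complex mat \<Rightarrow> complex mat) \<Rightarrow> bool" where
  "trace_preserving n F \<longleftrightarrow> (\<forall>A \<in> carrier_mat n n. mat_trace (F A) = mat_trace A)"

definition is_channel :: "nat \<Rightarrow> (complex mat \<Rightarrow> complex mat) \<Rightarrow> bool" where
  "is_channel n F \<longleftrightarrow> linear_on_mats n F \<and> completely_positive n F \<and> trace_preserving n F"

definition unital :: "nat \<Rightarrow> (complex mat \<Rightarrow> complex mat) \<Rightarrow> bool" where
  "unital n F \<longleftrightarrow> F (1\<^sub>m n) = 1\<^sub>m n"

(* Trace-orthogonality makes the four operators linearly independent, hence a basis of M_2. *)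
definition pauli_basis :: "(nat \<Rightarrow> complex mat) \<Rightarrow> bool" where
  "pauli_basis \<sigma> \<longleftrightarrow>
     \<sigma> 0 = 1\<^sub>m 2 \<and>
     (\<forall>j<4. self_adjoint 2 (\<sigma> j)) \<and>
     (\<forall>j<4. \<forall>k<4. mat_trace (\<sigma> j * \<sigma> k) = (if j = k then 2 else 0))"

definition pauli_diagonal :: "(complex mat \<Rightarrow> complex mat) \<Rightarrow> real \<Rightarrow> real \<Rightarrow> real \<Rightarrow> bool" where
  "pauli_diagonal E l1 l2 l3 \<longleftrightarrow>
     (\<exists>\<sigma>. pauli_basis \<sigma> \<and> E (1\<^sub>m 2) = 1\<^sub>m 2 \<and>
        E (\<sigma> 1) = complex_of_real l1 \<cdot>\<^sub>m \<sigma> 1 \<and>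
        E (\<sigma> 2) = complex_of_real l2 \<cdot>\<^sub>m \<sigma> 2 \<and>
        E (\<sigma> 3) = complex_of_real l3 \<cdot>\<^sub>m \<sigma> 3)"

definition separable :: "nat \<Rightarrow> nat \<Rightarrow> complex mat \<Rightarrow> bool" where
  "separable n m \<rho> \<longleftrightarrow>
     (\<exists>(N::nat) (p :: nat \<Rightarrow> real) \<alpha> \<beta>.
        (\<forall>k<N. 0 \<le> p k \<and> is_state n (\<alpha> k) \<and> is_state m (\<beta> k)) \<and>
        (\<Sum>k<N. p k) = 1 \<and>
        \<rho> = msum (n * m) (\<lambda>k. complex_of_real (p k) \<cdot>\<^sub>m mat_tensor (\<alpha> k) (\<beta> k)) {..<N})"

definition entanglement_annihilating :: "(complex mat \<Rightarrow> complex mat) \<Rightarrow> bool" where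
  "entanglement_annihilating F \<longleftrightarrow> (\<forall>\<rho>. is_state (2 * 2) \<rho> \<longrightarrow> separable 2 2 (F \<rho>))"

definition two_LEA :: "(complex mat \<Rightarrow> complex mat) \<Rightarrow> bool" where
  "two_LEA E \<longleftrightarrow> entanglement_annihilating (map_tensor 2 2 E E)"

definition entanglement_breaking :: "nat \<Rightarrow> (complex mat \<Rightarrow> complex mat) \<Rightarrow> bool" where
  "entanglement_breaking n F \<longleftrightarrow>
     (\<forall>m \<rho>. is_state (n * m) \<rho> \<longrightarrow> separable n m (map_tensor n m F id \<rho>))"

end

theory Submission
  imports Defs
begin

text \<open>
  Necessity. In every Pauli basis the singlet state is \<open>1/4 (1 \<otimes> 1 - \<Sum>j. \<sigma>\<^sub>j \<otimes> \<sigma>\<^sub>j)\<close>, so \<open>E \<otimes> E\<close> and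
  \<open>E\<^sup>2 \<otimes> id\<close> map it to the same matrix \<open>1/4 (1 \<otimes> 1 - \<Sum>j. \<lambda>\<^sub>j\<^sup>2 \<sigma>\<^sub>j \<otimes> \<sigma>\<^sub>j)\<close>. Its trace against the swap
  operator is \<open>(1 - \<Sum>j. \<lambda>\<^sub>j\<^sup>2) / 2\<close>, which must be nonnegative if the matrix is separable.

  Sufficiency. If \<open>\<Sum>j. \<lambda>\<^sub>j\<^sup>2 \<le> 1\<close>, then \<open>E\<^sup>2\<close> is a measure-and-prepare map with the operators
  \<open>1 \<plusminus> \<sigma>\<^sub>j\<close>, hence entanglement breaking. For \<open>E \<otimes> E\<close> it suffices to treat a pure input
  \<open>c e\<^sub>0 \<otimes> f\<^sub>0 + s e\<^sub>1 \<otimes> f\<^sub>1\<close> in Schmidt form. With \<open>X\<^sub>i\<close>, \<open>Y\<^sub>i\<close> the Pauli matrices of the two frames,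
  \<open>E X\<^sub>i = p\<^sub>i A\<^sub>i\<close> and \<open>E Y\<^sub>i = q\<^sub>i B\<^sub>i\<close>, where \<open>1 \<plusminus> A\<^sub>i\<close> and \<open>1 \<plusminus> B\<^sub>i\<close> are positive and
  \<open>\<Sum>i. p\<^sub>i\<^sup>2 = \<Sum>i. q\<^sub>i\<^sup>2 = \<Sum>j. \<lambda>\<^sub>j\<^sup>2\<close>, the output is, with \<open>t = c\<^sup>2 + s\<^sup>2\<close>, \<open>r = c\<^sup>2 - s\<^sup>2\<close>, \<open>S = 2 c s\<close>,
  one quarter of
  \<open>t (1 \<otimes> 1 + p\<^sub>3 q\<^sub>3 A\<^sub>3 \<otimes> B\<^sub>3) + r (p\<^sub>3 A\<^sub>3 \<otimes> 1 + q\<^sub>3 1 \<otimes> B\<^sub>3) + S (p\<^sub>1 q\<^sub>1 A\<^sub>1 \<otimes> B\<^sub>1 - p\<^sub>2 q\<^sub>2 A\<^sub>2 \<otimes> B\<^sub>2)\<close>.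
  This is a combination of the products \<open>(1 \<plusminus> A\<^sub>i) \<otimes> (1 \<plusminus> B\<^sub>i)\<close> whose coefficients are nonnegative
  by the Cauchy--Schwarz inequality and \<open>r\<^sup>2 + S\<^sup>2 = t\<^sup>2\<close>.
\<close>

section \<open>Positive semidefinite matrices\<close>

lemma quadratic_form_sum:
  assumes "A \<in> carrier_mat n n" "v \<in> carrier_vec n"
  shows "(A *\<^sub>v v) \<bullet>c v = (\<Sum>a<n. \<Sum>b<n. A $$ (a, b) * v $ b * cnj (v $ a))"
  using assms
  by (auto simp: scalar_prod_def atLeast0LessThan sum_distrib_right intro!: sum.cong)

lemma mat_adjoint_entry:
  assumes "A \<in> carrier_mat n n" "a < n" "b < n"
  shows "mat_adjoint A $$ (a, b) = cnj (A $$ (b, a))"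
  using assms by (simp add: mat_adjoint_def mat_of_rows_index)

lemma self_adjoint_iff:
  "self_adjoint n A \<longleftrightarrow> A \<in> carrier_mat n n \<and> (\<forall>a<n. \<forall>b<n. A $$ (b, a) = cnj (A $$ (a, b)))"
proof (cases "A \<in> carrier_mat n n")
  case True
  have "mat_adjoint A = A" if "\<forall>a<n. \<forall>b<n. A $$ (b, a) = cnj (A $$ (a, b))"
  proof (rule eq_matI)
    show "dim_row (mat_adjoint A) = dim_row A" "dim_col (mat_adjoint A) = dim_col A"
      using True by (simp_all add: mat_adjoint_def)
    fix a b assume "a < dim_row A" "b < dim_col A"
    then show "mat_adjoint A $$ (a, b) = A $$ (a, b)"
      using that True mat_adjoint_entry by (metis carrier_matD)
  qed
  moreover have "\<forall>a<n. \<forall>b<n. A $$ (b, a) = cnj (A $$ (a, b))" if "mat_adjoint A = A"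
    using mat_adjoint_entry[OF True] unfolding that by blast
  ultimately show ?thesis
    using True unfolding self_adjoint_def by blast
qed (simp add: self_adjoint_def)

text \<open>Only values below \<open>n\<close> enter the form, so vectors may be replaced by
  arbitrary functions on the naturals. The positivity proofs below work with this entrywise
  description.\<close>

lemma pos_semidef_iff:
  "pos_semidef n A \<longleftrightarrow> A \<in> carrier_mat n n \<and>
     (\<forall>a<n. \<forall>b<n. A $$ (b, a) = cnj (A $$ (a, b))) \<and>
     (\<forall>x. 0 \<le> Re (\<Sum>a<n. \<Sum>b<n. A $$ (a, b) * x b * cnj (x a)))"
proof (cases "A \<in> carrier_mat n n")
  case True
  have "(\<forall>v\<in>carrier_vec n. 0 \<le> Re ((A *\<^sub>v v) \<bullet>c v)) \<longleftrightarrow>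
    (\<forall>x. 0 \<le> Re (\<Sum>a<n. \<Sum>b<n. A $$ (a, b) * x b * cnj (x a)))" (is "?L \<longleftrightarrow> ?R")
  proof
    assume ?L
    show ?R
    proof
      fix x
      have "(A *\<^sub>v vec n x) \<bullet>c vec n x = (\<Sum>a<n. \<Sum>b<n. A $$ (a, b) * x b * cnj (x a))"
        using quadratic_form_sum[OF True, of "vec n x"] by simp
      then show "0 \<le> Re (\<Sum>a<n. \<Sum>b<n. A $$ (a, b) * x b * cnj (x a))"
        using \<open>?L\<close> by (metis vec_carrier)
    qed
  next
    assume ?R
    then show ?L using quadratic_form_sum[OF True] by auto
  qed
  with True show ?thesis unfolding pos_semidef_def self_adjoint_iff by auto
qed (simp add: pos_semidef_def self_adjoint_iff)


text \<open>Positive semidefiniteness of an array of entries; a function instead of a matrix lets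
  the elimination below rewrite \<open>B\<close> without carrier conditions.\<close>

definition herm_psd :: "nat \<Rightarrow> (nat \<Rightarrow> nat \<Rightarrow> complex) \<Rightarrow> bool" where
  "herm_psd n B \<longleftrightarrow> (\<forall>a<n. \<forall>b<n. B b a = cnj (B a b)) \<and>
     (\<forall>x. 0 \<le> Re (\<Sum>a<n. \<Sum>b<n. B a b * x b * cnj (x a)))"

text \<open>Expansion of the form when the single coordinate \<open>k\<close> moves by
  \<open>t\<close>. Here \<open>r x\<close> is entry \<open>k\<close> of the product of
  \<open>B\<close> with \<open>x\<close>, and hermiticity turns the matching column sum into its
  conjugate.\<close>

lemma quadratic_form_shift:
  fixes B :: "nat \<Rightarrow> nat \<Rightarrow> complex"
  assumes herm: "\<forall>a<n. \<forall>b<n. B b a = cnj (B a b)" and k: "k < n"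
  defines "r \<equiv> (\<lambda>x. \<Sum>b<n. B k b * x b)"
  defines "Q \<equiv> (\<lambda>x. \<Sum>a<n. \<Sum>b<n. B a b * x b * cnj (x a))"
  shows "Q (\<lambda>b. x b + (if b = k then t else 0)) = Q x + t * cnj (r x) + cnj t * r x + t * cnj t * B k k"
proof -
  let ?y = "\<lambda>b. x b + (if b = k then t else 0)"
  define R where "R a = (\<Sum>b<n. B a b * x b)" for a
  have inner: "(\<Sum>b<n. B a b * ?y b) = R a + B a k * t" for a
  proof -
    have "(\<Sum>b<n. B a b * ?y b) = (\<Sum>b<n. B a b * x b + (if b = k then B a k * t else 0))"
      by (rule sum.cong) (auto simp: algebra_simps)
    then show ?thesis using k by (simp add: sum.distrib R_def)
  qed
  have rk: "(\<Sum>a<n. B a k * cnj (x a)) = cnj (r x)"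
    unfolding r_def cnj_sum by (intro sum.cong refl) (metis herm k complex_cnj_mult lessThan_iff)
  have "Q ?y = (\<Sum>a<n. (R a + B a k * t) * cnj (?y a))"
    unfolding Q_def inner[symmetric] by (simp add: sum_distrib_right)
  also have "\<dots> = (\<Sum>a<n. R a * cnj (x a) + t * (B a k * cnj (x a)) +
      (if a = k then cnj t * R k + t * cnj t * B k k else 0))"
    by (rule sum.cong) (auto simp: algebra_simps)
  also have "\<dots> = (\<Sum>a<n. R a * cnj (x a)) + t * cnj (r x) + (cnj t * R k + t * cnj t * B k k)"
    using k by (simp add: sum.distrib sum_distrib_left[symmetric] rk)
  finally show ?thesis
    by (simp add: Q_def R_def r_def sum_distrib_right)
qed

text \<open>One step of Cholesky elimination. If the pivot \<open>B k k\<close> vanishes, then so does the whole row,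
  and division by zero makes the step trivial.\<close>

lemma herm_psd_eliminate:
  assumes B: "herm_psd n B" and k: "k < n"
  shows "herm_psd n (\<lambda>a b. B a b - B a k * B k b / B k k)"
    and "b < n \<Longrightarrow> B k b - B k k * B k b / B k k = 0"
    and "B k k = complex_of_real (Re (B k k))" and "0 \<le> Re (B k k)"
proof -
  define r where "r = (\<lambda>x. \<Sum>b<n. B k b * x b)"
  define Q where "Q = (\<lambda>x. \<Sum>a<n. \<Sum>b<n. B a b * x b * cnj (x a))"
  have herm: "\<forall>a<n. \<forall>b<n. B b a = cnj (B a b)"
    using B unfolding herm_psd_def by (rule conjunct1)
  have pos: "0 \<le> Re (Q x)" for x
    using B unfolding herm_psd_def Q_def by (elim conjE) (erule spec)
  have shift: "Q (\<lambda>b. x b + (if b = k then t else 0)) = Q x + t * cnj (r x) + cnj t * r x + t * cnj t * B k k"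
    for x t
    unfolding Q_def r_def by (rule quadratic_form_shift[OF herm k])
  show real: "B k k = complex_of_real (Re (B k k))"
    using herm k by (metis Reals_cnj_iff of_real_Re)
  define \<beta> where "\<beta> = Re (B k k)"
  have Bkk: "B k k = complex_of_real \<beta>" using real by (simp add: \<beta>_def)
  have "Q (\<lambda>_. 0) = 0" "r (\<lambda>_. 0) = 0"
    by (simp_all add: Q_def r_def)
  then have "Q (\<lambda>b. 0 + (if b = k then 1 else 0)) = B k k"
    using shift[of "\<lambda>_. 0" 1] by simp
  then show \<beta>0: "0 \<le> Re (B k k)" using pos by metis
  define N where "N x = (cmod (r x))\<^sup>2" for x
  have rr: "r x * cnj (r x) = complex_of_real (N x)" for x
    unfolding N_def by (rule complex_norm_square[symmetric])
  \<comment> \<open>The shift \<open>t = - s * r x\<close> makes both mixed terms real. The free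
    parameter \<open>s\<close> is chosen later: large for a zero pivot, the reciprocal of the pivot
    otherwise.\<close>
  have r_bound: "0 \<le> Re (Q x) - 2 * s * N x + s\<^sup>2 * N x * \<beta>" for s x
  proof -
    define t where "t = complex_of_real (- s) * r x"
    have "t * cnj (r x) = complex_of_real (- s) * (r x * cnj (r x))"
      "cnj t * r x = complex_of_real (- s) * (r x * cnj (r x))"
      "t * cnj t * B k k = complex_of_real (s\<^sup>2) * (r x * cnj (r x)) * complex_of_real \<beta>"
      by (simp_all add: t_def Bkk power2_eq_square mult_ac)
    then have "Re (Q x + t * cnj (r x) + cnj t * r x + t * cnj t * B k k) = Re (Q x) - 2 * s * N x + s\<^sup>2 * N x * \<beta>"
      by (simp add: rr flip: of_real_mult of_real_minus)
    then show ?thesis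
      using pos shift[of x t] by metis
  qed
  have r0: "r x = 0" if "\<beta> = 0" for x
  proof (rule ccontr)
    assume "r x \<noteq> 0"
    then have N: "0 < N x" by (simp add: N_def)
    \<comment> \<open>For a zero pivot the bound is affine in \<open>s\<close>, and this
      \<open>s\<close> would bring it down to -1.\<close>
    have "2 * ((Re (Q x) + 1) / (2 * N x)) * N x \<le> Re (Q x)"
      using r_bound[of x "(Re (Q x) + 1) / (2 * N x)"] that by simp
    then show False using N by simp
  qed
  have rd: "r (\<lambda>c. if c = b then 1 else 0) = B k b" if "b < n" for b
    using that by (simp add: r_def if_distrib[of "\<lambda>z. _ * z"] cong: if_cong)
  show "B k b - B k k * B k b / B k k = 0" if "b < n"
    using rd[OF that] r0 Bkk by (cases "\<beta> = 0") auto
  show "herm_psd n (\<lambda>a b. B a b - B a k * B k b / B k k)"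
    unfolding herm_psd_def
  proof (intro conjI allI impI)
    fix a b assume "a < n" "b < n"
    then have "B b a = cnj (B a b)" "B b k = cnj (B k b)" "B k a = cnj (B a k)"
      using herm k by metis+
    then show "B b a - B b k * B k a / B k k = cnj (B a b - B a k * B k b / B k k)"
      by (simp add: Bkk mult.commute)
  next
    fix x
    have rk: "(\<Sum>a<n. B a k * cnj (x a)) = cnj (r x)"
      unfolding r_def cnj_sum by (intro sum.cong refl) (metis herm k complex_cnj_mult lessThan_iff)
    have "(\<Sum>a<n. \<Sum>b<n. (B a b - B a k * B k b / B k k) * x b * cnj (x a)) =
      Q x - (\<Sum>a<n. \<Sum>b<n. (B a k * cnj (x a)) * (B k b * x b)) / B k k"
      by (simp add: Q_def sum_subtractf sum_divide_distrib algebra_simps)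
    also have "(\<Sum>a<n. \<Sum>b<n. (B a k * cnj (x a)) * (B k b * x b)) = cnj (r x) * r x"
      unfolding rk[symmetric] by (simp add: r_def sum_product)
    also have "Q x - cnj (r x) * r x / B k k = Q x - complex_of_real (N x / \<beta>)"
      by (simp add: Bkk rr mult.commute[of "cnj _"])
    finally have "Re (\<Sum>a<n. \<Sum>b<n. (B a b - B a k * B k b / B k k) * x b * cnj (x a)) =
        Re (Q x) - N x / \<beta>"
      by simp
    \<comment> \<open>For a positive pivot, \<open>s = 1 / \<beta>\<close> minimises the bound and
      gives the claim. For a zero pivot the subtracted quotient is 0 by convention.\<close>
    also have "\<dots> \<ge> 0"
      using r_bound[of x "1 / \<beta>"] pos[of x] by (cases "\<beta> = 0") (auto simp: power2_eq_square field_simps)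
    finally show "0 \<le> Re (\<Sum>a<n. \<Sum>b<n. (B a b - B a k * B k b / B k k) * x b * cnj (x a))" .
  qed
qed

text \<open>Cholesky decomposition: after \<open>k\<close> eliminations the remainder
  \<open>B\<close> is still positive and its first \<open>k\<close> rows vanish, so nothing remains
  after \<open>n\<close> steps. It takes the place of the spectral theorem.\<close>

lemma pos_semidef_rank_one_sum:
  assumes "pos_semidef n A"
  obtains v :: "nat \<Rightarrow> nat \<Rightarrow> complex"
  where "\<And>a b. a < n \<Longrightarrow> b < n \<Longrightarrow> A $$ (a, b) = (\<Sum>l<n. v l a * cnj (v l b))"
proof -
  have "\<exists>v B. herm_psd n B \<and> (\<forall>j<k. \<forall>b<n. B j b = 0) \<and>
      (\<forall>a<n. \<forall>b<n. A $$ (a, b) = B a b + (\<Sum>l<k. v l a * cnj (v l b)))" if "k \<le> n" for k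
    using that
  proof (induction k)
    case 0
    have "herm_psd n (\<lambda>a b. A $$ (a, b))"
      using assms unfolding herm_psd_def pos_semidef_iff by blast
    then show ?case by (intro exI[of _ "\<lambda>_ _. 0"] exI[of _ "\<lambda>a b. A $$ (a, b)"]) simp
  next
    case (Suc k)
    then obtain v B where B: "herm_psd n B" and rows: "\<forall>j<k. \<forall>b<n. B j b = 0"
      and A: "\<forall>a<n. \<forall>b<n. A $$ (a, b) = B a b + (\<Sum>l<k. v l a * cnj (v l b))"
      by auto
    have k: "k < n" using Suc.prems by simp
    note el = herm_psd_eliminate[OF B k]
    \<comment> \<open>The pivot column over the square root of the pivot. If the pivot is 0,
      division by zero makes the new vector 0, which agrees with the trivial elimination
      step.\<close>
    define v' where "v' = v(k := \<lambda>a. B a k / complex_of_real (sqrt (Re (B k k))))"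
    have v': "v' k a * cnj (v' k b) = B a k * B k b / B k k" if "b < n" for a b
    proof -
      have "complex_of_real (sqrt (Re (B k k))) * complex_of_real (sqrt (Re (B k k))) = B k k"
        using el(3,4) by (metis of_real_mult real_sqrt_mult_self abs_of_nonneg)
      moreover have "cnj (B b k) = B k b"
        using B that k unfolding herm_psd_def by metis
      ultimately show ?thesis by (simp add: v'_def)
    qed
    have "(\<Sum>l<k. v' l a * cnj (v' l b)) = (\<Sum>l<k. v l a * cnj (v l b))" for a b
      by (rule sum.cong) (auto simp: v'_def)
    with A v' have "\<forall>a<n. \<forall>b<n. A $$ (a, b) =
        (B a b - B a k * B k b / B k k) + (\<Sum>l<Suc k. v' l a * cnj (v' l b))"
      by simp
    moreover have "\<forall>j<Suc k. \<forall>b<n. B j b - B j k * B k b / B k k = 0"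
      using rows k el(2) by (auto simp: less_Suc_eq)
    ultimately show ?case using el(1) by blast
  qed
  from this[of n] obtain v B where "\<forall>j<n. \<forall>b<n. B j b = 0"
    "\<forall>a<n. \<forall>b<n. A $$ (a, b) = B a b + (\<Sum>l<n. v l a * cnj (v l b))"
    by blast
  then show thesis by (intro that[of v]) simp
qed

section \<open>The cone of separable matrices\<close>

lemma sum_lessThan_mult:
  fixes f :: "nat \<Rightarrow> nat \<Rightarrow> 'a::comm_monoid_add"
  shows "(\<Sum>i<n * m. f (i div m) (i mod m)) = (\<Sum>a<n. \<Sum>b<m. f a b)"
proof -
  have "(\<Sum>i<n * m. f (i div m) (i mod m)) = (\<Sum>a<n. \<Sum>i\<in>{a * m..<a * m + m}. f (i div m) (i mod m))"
    by (rule sum.nat_group[symmetric])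
  also have "\<dots> = (\<Sum>a<n. \<Sum>b<m. f a b)"
  proof (rule sum.cong[OF refl])
    fix a
    show "(\<Sum>i\<in>{a * m..<a * m + m}. f (i div m) (i mod m)) = (\<Sum>b<m. f a b)"
  proof -
    have "i div m = a \<and> i mod m = i - a * m" if "i \<in> {a * m..<a * m + m}" for i
    proof -
      have "i = a * m + (i - a * m)" "i - a * m < m" using that by auto
      then show ?thesis by (metis add.commute div_mult_self3 mod_mult_self3 div_less mod_less add_0 gr_implies_not0)
    qed
    then show ?thesis
      by (intro sum.reindex_bij_witness[of _ "\<lambda>b. a * m + b" "\<lambda>i. i - a * m"]) auto
    qed
  qed
  finally show ?thesis .
qed

lemma index_less_mult:
  fixes i k n m :: nat
  assumes "i < n" "k < m"
  shows "i * m + k < n * m"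
proof -
  have "i * m + k < Suc i * m" using assms by simp
  also have "\<dots> \<le> n * m" using assms by (intro mult_right_mono) auto
  finally show ?thesis .
qed

lemma div_mod_less_mult:
  fixes a n m :: nat
  assumes "a < n * m"
  shows "a div m < n" "a mod m < m"
  using assms by (auto simp: less_mult_imp_div_less intro!: mod_less_divisor gr0I)

lemma mat_tensor_dim [simp]:
  "dim_row (mat_tensor A B) = dim_row A * dim_row B"
  "dim_col (mat_tensor A B) = dim_col A * dim_col B"
  by (simp_all add: mat_tensor_def)

lemma mat_tensor_carrier [simp]:
  "A \<in> carrier_mat n n \<Longrightarrow> B \<in> carrier_mat m m \<Longrightarrow> mat_tensor A B \<in> carrier_mat (n * m) (n * m)"
  by (auto simp: mat_tensor_def)

lemma mat_tensor_entry:
  assumes "A \<in> carrier_mat n n" "B \<in> carrier_mat m m" "a < n * m" "b < n * m"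
  shows "mat_tensor A B $$ (a, b) = A $$ (a div m, b div m) * B $$ (a mod m, b mod m)"
  using assms by (auto simp: mat_tensor_def)

lemma mat_trace_tensor:
  assumes "A \<in> carrier_mat n n" "B \<in> carrier_mat m m"
  shows "mat_trace (mat_tensor A B) = mat_trace A * mat_trace B"
proof -
  have "mat_trace (mat_tensor A B) = (\<Sum>i<n * m. A $$ (i div m, i div m) * B $$ (i mod m, i mod m))"
    unfolding mat_trace_def using assms by (intro sum.cong) (auto simp: mat_tensor_entry mat_tensor_def)
  also have "\<dots> = mat_trace A * mat_trace B"
    using assms by (simp add: sum_lessThan_mult[of "\<lambda>a b. A $$ (a, a) * B $$ (b, b)"] mat_trace_def sum_product)
  finally show ?thesis .
qed

lemma msum_carrier [simp]: "msum n f S \<in> carrier_mat n n"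
  by (simp add: msum_def)

lemma pos_semidef_carrier: "pos_semidef n A \<Longrightarrow> A \<in> carrier_mat n n"
  by (simp add: pos_semidef_iff)

lemma pos_semidef_smult:
  assumes A: "pos_semidef n A" and c: "0 \<le> c"
  shows "pos_semidef n (complex_of_real c \<cdot>\<^sub>m A)"
  unfolding pos_semidef_iff
proof (intro conjI allI impI)
  note C = pos_semidef_carrier[OF A]
  then show "complex_of_real c \<cdot>\<^sub>m A \<in> carrier_mat n n"
    by simp
  show "(complex_of_real c \<cdot>\<^sub>m A) $$ (b, a) = cnj ((complex_of_real c \<cdot>\<^sub>m A) $$ (a, b))"
    if ab: "a < n" "b < n" for a b
  proof -
    have "A $$ (b, a) = cnj (A $$ (a, b))" using A ab unfolding pos_semidef_iff by blast
    then show ?thesis using C ab by simp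
  qed
  fix x
  have "(\<Sum>a<n. \<Sum>b<n. (complex_of_real c \<cdot>\<^sub>m A) $$ (a, b) * x b * cnj (x a)) =
      complex_of_real c * (\<Sum>a<n. \<Sum>b<n. A $$ (a, b) * x b * cnj (x a))"
    unfolding sum_distrib_left using C by (intro sum.cong refl) (auto simp: mult_ac)
  moreover have "0 \<le> Re (\<Sum>a<n. \<Sum>b<n. A $$ (a, b) * x b * cnj (x a))"
    using A unfolding pos_semidef_iff by blast
  ultimately show "0 \<le> Re (\<Sum>a<n. \<Sum>b<n. (complex_of_real c \<cdot>\<^sub>m A) $$ (a, b) * x b * cnj (x a))"
    using c by simp
qed

text \<open>In a sum of rank-one terms the trace is the sum of all squared moduli, hence it vanishes
  only for the zero matrix. This covers the operators that cannot be rescaled to states.\<close>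

lemma pos_semidef_trace:
  assumes A: "pos_semidef n A"
  obtains t where "mat_trace A = complex_of_real t" "0 \<le> t" "t = 0 \<Longrightarrow> A = 0\<^sub>m n n"
proof -
  obtain v where v: "\<And>a b. a < n \<Longrightarrow> b < n \<Longrightarrow> A $$ (a, b) = (\<Sum>l<n. v l a * cnj (v l b))"
    using pos_semidef_rank_one_sum[OF A] by blast
  let ?t = "\<Sum>a<n. \<Sum>l<n. (cmod (v l a))\<^sup>2"
  have AC: "A \<in> carrier_mat n n" using A by (rule pos_semidef_carrier)
  have tr: "mat_trace A = complex_of_real ?t"
    using AC by (simp add: mat_trace_def v of_real_sum complex_norm_square del: of_real_power)
  have "A = 0\<^sub>m n n" if "?t = 0"
  proof -
    have "\<forall>a<n. \<forall>l<n. v l a = 0"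
      using that by (simp add: sum_nonneg_eq_0_iff sum_nonneg)
    then show ?thesis
      using AC by (intro eq_matI) (auto simp: v)
  qed
  moreover have "0 \<le> ?t" by (intro sum_nonneg) simp
  ultimately show thesis using tr by (intro that[of ?t])
qed

text \<open>The separable matrices without the normalisation; unlike \<^const>\<open>separable\<close>, it is closed
  under sums and nonnegative multiples.\<close>

inductive_set sep_cone :: "nat \<Rightarrow> nat \<Rightarrow> complex mat set" for n m where
  zero: "0\<^sub>m (n * m) (n * m) \<in> sep_cone n m"
| add: "X \<in> sep_cone n m \<Longrightarrow> pos_semidef n \<alpha> \<Longrightarrow> pos_semidef m \<beta> \<Longrightarrow>
    X + mat_tensor \<alpha> \<beta> \<in> sep_cone n m"

lemma sep_cone_carrier: "X \<in> sep_cone n m \<Longrightarrow> X \<in> carrier_mat (n * m) (n * m)"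
  by (induction rule: sep_cone.induct) (auto dest!: pos_semidef_carrier)

lemma sep_cone_tensor:
  assumes "pos_semidef n \<alpha>" "pos_semidef m \<beta>"
  shows "mat_tensor \<alpha> \<beta> \<in> sep_cone n m"
  using sep_cone.add[OF sep_cone.zero assms] assms[THEN pos_semidef_carrier] by simp

lemma sep_cone_add:
  assumes "Y \<in> sep_cone n m" "X \<in> sep_cone n m"
  shows "X + Y \<in> sep_cone n m"
  using assms
proof (induction rule: sep_cone.induct)
  case zero
  then show ?case using sep_cone_carrier by force
next
  case (add Y \<alpha> \<beta>)
  note C = sep_cone_carrier[OF add.prems] sep_cone_carrier[OF add.hyps(1)]
    add.hyps(2,3)[THEN pos_semidef_carrier]
  have "X + (Y + mat_tensor \<alpha> \<beta>) = (X + Y) + mat_tensor \<alpha> \<beta>"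
    by (rule assoc_add_mat[symmetric, OF C(1,2) mat_tensor_carrier[OF C(3,4)]])
  then show ?case using add by (simp add: sep_cone.add)
qed

lemma sep_cone_smult:
  assumes "X \<in> sep_cone n m" "0 \<le> c"
  shows "complex_of_real c \<cdot>\<^sub>m X \<in> sep_cone n m"
  using assms
proof (induction rule: sep_cone.induct)
  case zero
  have "complex_of_real c \<cdot>\<^sub>m 0\<^sub>m (n * m) (n * m) = 0\<^sub>m (n * m) (n * m)" by auto
  then show ?case using sep_cone.zero by simp
next
  case (add X \<alpha> \<beta>)
  note C = sep_cone_carrier[OF add.hyps(1)] add.hyps(2,3)[THEN pos_semidef_carrier]
  have "complex_of_real c \<cdot>\<^sub>m (X + mat_tensor \<alpha> \<beta>) =
      complex_of_real c \<cdot>\<^sub>m X + mat_tensor (complex_of_real c \<cdot>\<^sub>m \<alpha>) \<beta>"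
    using C by (intro eq_matI) (auto simp: mat_tensor_entry[of _ n _ m] algebra_simps div_mod_less_mult)
  then show ?case
    using add by (simp add: sep_cone.add pos_semidef_smult)
qed

lemma sep_cone_msum:
  assumes "finite S" "\<And>s. s \<in> S \<Longrightarrow> f s \<in> sep_cone n m"
  shows "msum (n * m) f S \<in> sep_cone n m"
  using assms
proof (induction rule: finite_induct)
  case empty
  have "msum (n * m) f {} = 0\<^sub>m (n * m) (n * m)" by (auto simp: msum_def)
  then show ?case using sep_cone.zero by metis
next
  case (insert s S)
  have "msum (n * m) f (insert s S) = f s + msum (n * m) f S"
    using insert.hyps sep_cone_carrier[OF insert.prems[of s]]
    by (intro eq_matI) (auto simp: msum_def)
  then show ?case using insert sep_cone_add by simp
qed

text \<open>Both factors of a product are divided by their traces \<open>t\<close> and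
  \<open>u\<close>, and \<open>t * u\<close> becomes the weight. A factor of trace 0 makes the
  product vanish, so that such a term is dropped. The weights are not normalised yet.\<close>

lemma sep_cone_states:
  assumes "X \<in> sep_cone n m"
  shows "\<exists>(N::nat) (p :: nat \<Rightarrow> real) \<alpha> \<beta>.
        (\<forall>k<N. 0 \<le> p k \<and> is_state n (\<alpha> k) \<and> is_state m (\<beta> k)) \<and>
        X = msum (n * m) (\<lambda>k. complex_of_real (p k) \<cdot>\<^sub>m mat_tensor (\<alpha> k) (\<beta> k)) {..<N}"
  using assms
proof (induction rule: sep_cone.induct)
  case zero
  show ?case by (rule exI[of _ 0]) (auto simp: msum_def)
next
  case (add X \<alpha> \<beta>)
  note C = sep_cone_carrier[OF add.hyps(1)] add.hyps(2,3)[THEN pos_semidef_carrier]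
  from add.IH obtain N p A B where st: "\<forall>k<N. 0 \<le> p k \<and> is_state n (A k) \<and> is_state m (B k)"
    and X: "X = msum (n * m) (\<lambda>k. complex_of_real (p k) \<cdot>\<^sub>m mat_tensor (A k) (B k)) {..<(N::nat)}"
    by blast
  obtain t where t: "mat_trace \<alpha> = complex_of_real t" "0 \<le> t" "t = 0 \<Longrightarrow> \<alpha> = 0\<^sub>m n n"
    using pos_semidef_trace[OF add.hyps(2)] by blast
  obtain u where u: "mat_trace \<beta> = complex_of_real u" "0 \<le> u" "u = 0 \<Longrightarrow> \<beta> = 0\<^sub>m m m"
    using pos_semidef_trace[OF add.hyps(3)] by blast
  show ?case
  proof (cases "t = 0 \<or> u = 0")
    case True
    then have "X + mat_tensor \<alpha> \<beta> = X"
      using C t(3) u(3) by (intro eq_matI) (auto simp: mat_tensor_entry[of _ n _ m] div_mod_less_mult)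
    then show ?thesis using add.IH by simp
  next
    case False
    have state: "is_state k (complex_of_real (1 / r) \<cdot>\<^sub>m D)"
      if "pos_semidef k D" "mat_trace D = complex_of_real r" "0 \<le> r" "r \<noteq> 0" for k D r
    proof -
      have "mat_trace (complex_of_real (1 / r) \<cdot>\<^sub>m D) = complex_of_real (1 / r) * mat_trace D"
        using pos_semidef_carrier[OF that(1)] by (simp add: mat_trace_def sum_distrib_left)
      then show ?thesis
        using that pos_semidef_smult[of k D "1 / r"] by (simp add: is_state_def)
    qed
    define p' A' B' where "p' = p(N := t * u)" and "A' = A(N := complex_of_real (1 / t) \<cdot>\<^sub>m \<alpha>)"
      and "B' = B(N := complex_of_real (1 / u) \<cdot>\<^sub>m \<beta>)"
    have "\<forall>k<Suc N. 0 \<le> p' k \<and> is_state n (A' k) \<and> is_state m (B' k)"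
      using st t u False state[OF add.hyps(2) t(1,2)] state[OF add.hyps(3) u(1,2)]
      by (simp add: p'_def A'_def B'_def less_Suc_eq)
    moreover have "X + mat_tensor \<alpha> \<beta> =
        msum (n * m) (\<lambda>k. complex_of_real (p' k) \<cdot>\<^sub>m mat_tensor (A' k) (B' k)) {..<Suc N}"
    proof (rule eq_matI)
      fix a b
      assume "a < dim_row (msum (n * m) (\<lambda>k. complex_of_real (p' k) \<cdot>\<^sub>m mat_tensor (A' k) (B' k)) {..<Suc N})"
        "b < dim_col (msum (n * m) (\<lambda>k. complex_of_real (p' k) \<cdot>\<^sub>m mat_tensor (A' k) (B' k)) {..<Suc N})"
      then have ab: "a < n * m" "b < n * m" by (simp_all add: msum_def)
      have "(\<Sum>k<N. (complex_of_real (p' k) \<cdot>\<^sub>m mat_tensor (A' k) (B' k)) $$ (a, b)) =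
          (\<Sum>k<N. (complex_of_real (p k) \<cdot>\<^sub>m mat_tensor (A k) (B k)) $$ (a, b))"
        by (rule sum.cong) (auto simp: p'_def A'_def B'_def)
      moreover have "(complex_of_real (p' N) \<cdot>\<^sub>m mat_tensor (A' N) (B' N)) $$ (a, b) = mat_tensor \<alpha> \<beta> $$ (a, b)"
        using False C(2,3) ab carrier_matD[OF mat_tensor_carrier[OF C(2,3)]]
        by (simp add: p'_def A'_def B'_def mat_tensor_def mult_ac div_mod_less_mult)
      ultimately show "(X + mat_tensor \<alpha> \<beta>) $$ (a, b) =
          msum (n * m) (\<lambda>k. complex_of_real (p' k) \<cdot>\<^sub>m mat_tensor (A' k) (B' k)) {..<Suc N} $$ (a, b)"
        using ab carrier_matD[OF mat_tensor_carrier[OF C(2,3)]]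
        unfolding X by (simp add: msum_def)
    qed (use carrier_matD[OF mat_tensor_carrier[OF C(2,3)]] in \<open>simp_all add: msum_def\<close>)
    ultimately show ?thesis by blast
  qed
qed

text \<open>Products of states have trace 1, so the weights add up to the trace of
  \<open>X\<close>.\<close>

lemma sep_cone_separable:
  assumes "X \<in> sep_cone n m" "mat_trace X = 1"
  shows "separable n m X"
proof -
  obtain N p A B where st: "\<forall>k<N. 0 \<le> p k \<and> is_state n (A k) \<and> is_state m (B k)"
    and X: "X = msum (n * m) (\<lambda>k. complex_of_real (p k) \<cdot>\<^sub>m mat_tensor (A k) (B k)) {..<(N::nat)}"
    using sep_cone_states[OF assms(1)] by blast
  have C: "A k \<in> carrier_mat n n" "B k \<in> carrier_mat m m" if "k < N" for k
    using st that by (auto simp: is_state_def dest: pos_semidef_carrier)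
  have "mat_trace X = (\<Sum>i<n * m. \<Sum>k<N. complex_of_real (p k) * mat_tensor (A k) (B k) $$ (i, i))"
    unfolding X mat_trace_def msum_def using carrier_matD[OF mat_tensor_carrier[OF C]]
    by (auto intro!: sum.cong)
  also have "\<dots> = (\<Sum>k<N. complex_of_real (p k) * mat_trace (mat_tensor (A k) (B k)))"
    unfolding mat_trace_def sum_distrib_left using carrier_matD[OF mat_tensor_carrier[OF C]]
    by (subst sum.swap) (auto intro!: sum.cong)
  also have "\<dots> = complex_of_real (\<Sum>k<N. p k)"
    unfolding of_real_sum using st C by (intro sum.cong) (auto simp: mat_trace_tensor[of _ n _ m] is_state_def)
  finally have "(\<Sum>k<N. p k) = 1"
    using assms(2) by (metis of_real_eq_1_iff)
  with st X show ?thesis unfolding separable_def by blast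
qed

section \<open>Tensor products of maps and Pauli bases\<close>

lemma mat_unit_carrier [simp]: "mat_unit n i j \<in> carrier_mat n n"
  by (simp add: mat_unit_def)

lemma linear_on_mats_carrier:
  "linear_on_mats n F \<Longrightarrow> A \<in> carrier_mat n n \<Longrightarrow> F A \<in> carrier_mat n n"
  by (simp add: linear_on_mats_def)

lemma map_tensor_carrier [simp]: "map_tensor n m F G X \<in> carrier_mat (n * m) (n * m)"
  by (simp add: map_tensor_def)

lemma map_tensor_entry:
  assumes "linear_on_mats n F" "linear_on_mats m G" "a < n * m" "b < n * m"
  shows "map_tensor n m F G X $$ (a, b) =
    (\<Sum>(i, j, k, l)\<in>{..<n} \<times> {..<n} \<times> {..<m} \<times> {..<m}. X $$ (i * m + k, j * m + l) *
       (F (mat_unit n i j) $$ (a div m, b div m) * G (mat_unit m k l) $$ (a mod m, b mod m)))"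
proof -
  have C: "F (mat_unit n i j) \<in> carrier_mat n n" "G (mat_unit m i j) \<in> carrier_mat m m" for i j
    using assms(1,2) by (auto intro: linear_on_mats_carrier)
  show ?thesis
    using assms(3,4) mat_tensor_entry[OF C(1) C(2) assms(3,4)] carrier_matD[OF C(1)] carrier_matD[OF C(2)]
    by (auto simp: map_tensor_def msum_def intro!: sum.cong)
qed

lemma map_tensor_msum:
  assumes F: "linear_on_mats n F" and G: "linear_on_mats m G"
  shows "map_tensor n m F G (msum (n * m) f S) = msum (n * m) (\<lambda>s. map_tensor n m F G (f s)) S"
proof (rule eq_matI)
  fix a b
  assume "a < dim_row (msum (n * m) (\<lambda>s. map_tensor n m F G (f s)) S)"
    "b < dim_col (msum (n * m) (\<lambda>s. map_tensor n m F G (f s)) S)"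
  then have ab: "a < n * m" "b < n * m" by (simp_all add: msum_def)
  let ?I = "{..<n} \<times> {..<n} \<times> {..<m} \<times> {..<m}"
  let ?W = "\<lambda>i j k l. F (mat_unit n i j) $$ (a div m, b div m) * G (mat_unit m k l) $$ (a mod m, b mod m)"
  have "map_tensor n m F G (msum (n * m) f S) $$ (a, b) =
      (\<Sum>(i, j, k, l)\<in>?I. \<Sum>s\<in>S. f s $$ (i * m + k, j * m + l) * ?W i j k l)"
    unfolding map_tensor_entry[OF F G ab]
    by (intro sum.cong) (auto simp: msum_def index_less_mult sum_distrib_right)
  also have "\<dots> = (\<Sum>s\<in>S. \<Sum>(i, j, k, l)\<in>?I. f s $$ (i * m + k, j * m + l) * ?W i j k l)"
    unfolding case_prod_unfold by (rule sum.swap)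
  also have "\<dots> = msum (n * m) (\<lambda>s. map_tensor n m F G (f s)) S $$ (a, b)"
    using ab by (simp add: msum_def map_tensor_entry[OF F G ab])
  finally show "map_tensor n m F G (msum (n * m) f S) $$ (a, b) =
      msum (n * m) (\<lambda>s. map_tensor n m F G (f s)) S $$ (a, b)" .
qed (simp_all add: msum_def map_tensor_def)

lemma map_tensor_smult:
  assumes F: "linear_on_mats n F" and G: "linear_on_mats m G"
    and X: "X \<in> carrier_mat (n * m) (n * m)"
  shows "map_tensor n m F G (c \<cdot>\<^sub>m X) = c \<cdot>\<^sub>m map_tensor n m F G X"
proof (rule eq_matI)
  fix a b
  assume "a < dim_row (c \<cdot>\<^sub>m map_tensor n m F G X)" "b < dim_col (c \<cdot>\<^sub>m map_tensor n m F G X)"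
  then have ab: "a < n * m" "b < n * m" by (simp_all add: map_tensor_def msum_def)
  then have "(c \<cdot>\<^sub>m map_tensor n m F G X) $$ (a, b) = c * map_tensor n m F G X $$ (a, b)"
    by (simp add: map_tensor_def msum_def)
  then show "map_tensor n m F G (c \<cdot>\<^sub>m X) $$ (a, b) = (c \<cdot>\<^sub>m map_tensor n m F G X) $$ (a, b)"
    unfolding map_tensor_entry[OF F G ab] sum_distrib_left
    using X by (auto simp: index_less_mult intro!: sum.cong)
qed (simp_all add: msum_def map_tensor_def)

text \<open>The singlet and the pure states in Schmidt form are both pushed through a tensor product
  of maps by this rule.\<close>

lemma map_tensor_tensor_sum:
  assumes F: "linear_on_mats n F" and G: "linear_on_mats m G"
    and A: "\<And>s. s \<in> S \<Longrightarrow> A s \<in> carrier_mat n n" and B: "\<And>s. s \<in> S \<Longrightarrow> B s \<in> carrier_mat m m"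
  shows "map_tensor n m F G (msum (n * m) (\<lambda>s. c s \<cdot>\<^sub>m mat_tensor (A s) (B s)) S) =
    msum (n * m) (\<lambda>s. c s \<cdot>\<^sub>m mat_tensor (F (A s)) (G (B s))) S"
  unfolding map_tensor_msum[OF F G]
  using A B by (auto simp: msum_def map_tensor_smult[OF F G] map_tensor_mat_tensor[OF F G] intro!: sum.cong)

text \<open>A trace-preserving map sends a matrix unit to a matrix of trace 1 or 0 according to
  \<open>i = j\<close>, so only the diagonal entries of \<open>X\<close> survive.\<close>

lemma map_tensor_trace:
  assumes F: "linear_on_mats n F" "trace_preserving n F" and G: "linear_on_mats m G" "trace_preserving m G"
    and X: "X \<in> carrier_mat (n * m) (n * m)"
  shows "mat_trace (map_tensor n m F G X) = mat_trace X"
proof -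
  have unit: "mat_trace (mat_unit k i j) = (if i = j then 1 else 0)" if "i < k" "j < k" for k i j
    using that by (auto simp: mat_trace_def mat_unit_def)
  have tr: "mat_trace (H (mat_unit k i j)) = (if i = j then 1 else 0)"
    if "linear_on_mats k H" "trace_preserving k H" "i < k" "j < k" for H k i j
    using that unit unfolding trace_preserving_def by simp
  have C: "F (mat_unit n i j) \<in> carrier_mat n n" "G (mat_unit m i j) \<in> carrier_mat m m" for i j
    using F G by (auto intro: linear_on_mats_carrier)
  let ?I = "{..<n} \<times> {..<n} \<times> {..<m} \<times> {..<m}"
  have "mat_trace (map_tensor n m F G X) = (\<Sum>a<n * m. \<Sum>(i, j, k, l)\<in>?I. X $$ (i * m + k, j * m + l) *
       (F (mat_unit n i j) $$ (a div m, a div m) * G (mat_unit m k l) $$ (a mod m, a mod m)))"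
    unfolding mat_trace_def carrier_matD[OF map_tensor_carrier]
    by (intro sum.cong refl map_tensor_entry) (use F G in auto)
  also have "\<dots> = (\<Sum>(i, j, k, l)\<in>?I. X $$ (i * m + k, j * m + l) *
       (\<Sum>a<n * m. F (mat_unit n i j) $$ (a div m, a div m) * G (mat_unit m k l) $$ (a mod m, a mod m)))"
    unfolding case_prod_unfold sum_distrib_left by (rule sum.swap)
  also have "\<dots> = (\<Sum>(i, j, k, l)\<in>?I. X $$ (i * m + k, j * m + l) *
       (mat_trace (F (mat_unit n i j)) * mat_trace (G (mat_unit m k l))))"
    unfolding mat_trace_def carrier_matD[OF C(1)] carrier_matD[OF C(2)] sum_product
    by (simp only: sum_lessThan_mult[of "\<lambda>a b. F (mat_unit n i j) $$ (a, a) * G (mat_unit m k l) $$ (b, b)" for i j k l])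
  also have "\<dots> = (\<Sum>i<n. \<Sum>j<n. \<Sum>k<m. \<Sum>l<m. X $$ (i * m + k, j * m + l) *
       ((if i = j then 1 else 0) * (if k = l then 1 else 0)))"
    unfolding sum.cartesian_product
    by (intro sum.cong) (auto simp: tr[OF F] tr[OF G])
  also have "\<dots> = (\<Sum>i<n. \<Sum>j<n. if j = i then \<Sum>k<m. \<Sum>l<m. if l = k then X $$ (i * m + k, j * m + l) else 0 else 0)"
    by (intro sum.cong refl) (auto simp: if_distrib[of "\<lambda>z. _ * z"] cong: if_cong intro!: sum.cong)
  also have "\<dots> = (\<Sum>i<n. \<Sum>k<m. X $$ (i * m + k, i * m + k))"
    by simp
  also have "\<dots> = (\<Sum>i<n * m. X $$ (i, i))"
    using sum_lessThan_mult[of "\<lambda>i k. X $$ (i * m + k, i * m + k)" m n] by simp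
  finally show ?thesis using X by (simp add: mat_trace_def)
qed

section \<open>Expansion in a Pauli basis and diagonal maps\<close>

lemma mat_trace_mult:
  assumes "A \<in> carrier_mat n n" "B \<in> carrier_mat n n"
  shows "mat_trace (A * B) = (\<Sum>a<n. \<Sum>b<n. A $$ (a, b) * B $$ (b, a))"
  using assms by (simp add: mat_trace_def scalar_prod_def atLeast0LessThan)

lemma sum_lessThan_2: "(\<Sum>i<(2::nat). f i) = f 0 + f 1"
  by (simp add: numeral_2_eq_2)

lemma sum_lessThan_4: "(\<Sum>i<(4::nat). f i) = f 0 + f 1 + f 2 + f 3"
  by (simp add: eval_nat_numeral)

lemma pauli_basis_carrier: "pauli_basis \<sigma> \<Longrightarrow> j < 4 \<Longrightarrow> \<sigma> j \<in> carrier_mat 2 2"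
  by (auto simp: pauli_basis_def self_adjoint_def)

text \<open>Trace-orthogonality says \<open>S * W = 1\<close> for the 4 x 4 matrices that list the
  entries of the basis. A right inverse of a square matrix is a left inverse, and
  \<open>W * S = 1\<close> is the claim: the sum of \<open>\<sigma> j\<close> \<otimes>
  \<open>\<sigma> j\<close> is twice the swap operator.\<close>

lemma pauli_basis_completeness:
  assumes \<sigma>: "pauli_basis \<sigma>" and "a < 2" "b < 2" "c < 2" "d < 2"
  shows "(\<Sum>j<4. \<sigma> j $$ (a, b) * \<sigma> j $$ (c, d)) = (if a = d \<and> b = c then 2 else 0)"
proof -
  define S where "S = mat 4 4 (\<lambda>(j, x). \<sigma> j $$ (x div 2, x mod 2))"
  define W where "W = mat 4 4 (\<lambda>(x, k). \<sigma> k $$ (x mod 2, x div 2) / 2)"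
  have C: "S \<in> carrier_mat 4 4" "W \<in> carrier_mat 4 4" by (simp_all add: S_def W_def)
  have "S * W = 1\<^sub>m 4"
  proof (rule eq_matI)
    fix j k assume "j < dim_row (1\<^sub>m 4 :: complex mat)" "k < dim_col (1\<^sub>m 4 :: complex mat)"
    then have jk: "j < 4" "k < 4" by simp_all
    have "(S * W) $$ (j, k) = (\<Sum>x<2 * 2. \<sigma> j $$ (x div 2, x mod 2) * (\<sigma> k $$ (x mod 2, x div 2) / 2))"
      using jk by (simp add: S_def W_def scalar_prod_def atLeast0LessThan)
    also have "\<dots> = mat_trace (\<sigma> j * \<sigma> k) / 2"
      using jk \<sigma> by (subst sum_lessThan_mult[of "\<lambda>a b. \<sigma> j $$ (a, b) * (\<sigma> k $$ (b, a) / 2)"])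
        (simp add: mat_trace_mult[of _ 2] pauli_basis_carrier sum_divide_distrib)
    finally show "(S * W) $$ (j, k) = 1\<^sub>m 4 $$ (j, k)"
      using jk \<sigma> by (cases "j = k") (auto simp: pauli_basis_def)
  qed (use C in auto)
  then have WS: "W * S = 1\<^sub>m 4"
    using mat_mult_left_right_inverse[OF C] by simp
  have xy: "b * 2 + a < 4" "c * 2 + d < 4" using assms by auto
  have "(\<Sum>j<4. \<sigma> j $$ (a, b) * \<sigma> j $$ (c, d)) = 2 * (W * S) $$ (b * 2 + a, c * 2 + d)"
    using xy assms by (simp add: S_def W_def scalar_prod_def atLeast0LessThan sum_distrib_left)
  also have "\<dots> = (if b * 2 + a = c * 2 + d then 2 else 0)"
    using xy unfolding WS by simp
  also have "b * 2 + a = c * 2 + d \<longleftrightarrow> a = d \<and> b = c"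
    using assms by presburger
  finally show ?thesis .
qed

definition pauli_coeff :: "(nat \<Rightarrow> complex mat) \<Rightarrow> nat \<Rightarrow> complex mat \<Rightarrow> complex" where
  "pauli_coeff \<sigma> j X = mat_trace (\<sigma> j * X) / 2"

lemma pauli_expansion:
  assumes \<sigma>: "pauli_basis \<sigma>" and X: "X \<in> carrier_mat 2 2" and ab: "a < 2" "b < 2"
  shows "X $$ (a, b) = (\<Sum>j<4. pauli_coeff \<sigma> j X * \<sigma> j $$ (a, b))"
proof -
  note C = pauli_basis_carrier[OF \<sigma>]
  have "(\<Sum>j<4. pauli_coeff \<sigma> j X * \<sigma> j $$ (a, b)) =
      (\<Sum>j<4. \<Sum>c<2. \<Sum>d<2. X $$ (d, c) / 2 * (\<sigma> j $$ (c, d) * \<sigma> j $$ (a, b)))"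
    by (intro sum.cong refl)
      (simp add: pauli_coeff_def mat_trace_mult[OF C X] sum_lessThan_2 field_simps)
  also have "\<dots> = (\<Sum>c<2. \<Sum>d<2. X $$ (d, c) / 2 * (\<Sum>j<4. \<sigma> j $$ (c, d) * \<sigma> j $$ (a, b)))"
    by (simp add: sum_lessThan_2 sum_lessThan_4 algebra_simps)
  also have "\<dots> = (\<Sum>c<2. \<Sum>d<2. X $$ (d, c) / 2 * (if c = b \<and> d = a then 2 else 0))"
    by (intro sum.cong refl) (use pauli_basis_completeness[OF \<sigma> _ _ ab] in auto)
  also have "\<dots> = X $$ (a, b)"
    using ab by (auto simp: less_2_cases_iff sum_lessThan_2)
  finally show ?thesis ..
qed

text \<open>The diagonal entries form one function with \<open>L 0 = 1\<close>, so that sums over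
  the basis include the identity. The basis is a parameter, so that maps diagonal in the same basis
  can be composed and compared.\<close>

definition pauli_map :: "(complex mat \<Rightarrow> complex mat) \<Rightarrow> (nat \<Rightarrow> complex mat) \<Rightarrow> (nat \<Rightarrow> real) \<Rightarrow> bool" where
  "pauli_map F \<sigma> L \<longleftrightarrow> linear_on_mats 2 F \<and> pauli_basis \<sigma> \<and> L 0 = 1 \<and>
     (\<forall>j<4. F (\<sigma> j) = complex_of_real (L j) \<cdot>\<^sub>m \<sigma> j)"

lemma pauli_map_entry:
  assumes F: "pauli_map F \<sigma> L" and X: "X \<in> carrier_mat 2 2" and ab: "a < 2" "b < 2"
  shows "F X $$ (a, b) = (\<Sum>j<4. complex_of_real (L j) * pauli_coeff \<sigma> j X * \<sigma> j $$ (a, b))"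
proof -
  have lin: "linear_on_mats 2 F" and \<sigma>: "pauli_basis \<sigma>"
    and F\<sigma>: "\<And>j. j < 4 \<Longrightarrow> F (\<sigma> j) = complex_of_real (L j) \<cdot>\<^sub>m \<sigma> j"
    using F by (auto simp: pauli_map_def)
  note C = pauli_basis_carrier[OF \<sigma>]
  have "F X $$ (a, b) = (\<Sum>i<2. \<Sum>k<2. \<Sum>j<4. pauli_coeff \<sigma> j X * (\<sigma> j $$ (i, k) * F (mat_unit 2 i k) $$ (a, b)))"
    unfolding linear_on_mats_expand[OF lin X ab]
    by (intro sum.cong refl) (simp add: pauli_expansion[OF \<sigma> X] sum_distrib_left sum_distrib_right mult_ac)
  also have "\<dots> = (\<Sum>j<4. pauli_coeff \<sigma> j X * (\<Sum>i<2. \<Sum>k<2. \<sigma> j $$ (i, k) * F (mat_unit 2 i k) $$ (a, b)))"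
    by (simp add: sum_lessThan_2 sum_lessThan_4 algebra_simps)
  also have "\<dots> = (\<Sum>j<4. pauli_coeff \<sigma> j X * F (\<sigma> j) $$ (a, b))"
    by (intro sum.cong refl) (use linear_on_mats_expand[OF lin C ab] in auto)
  also have "\<dots> = (\<Sum>j<4. complex_of_real (L j) * pauli_coeff \<sigma> j X * \<sigma> j $$ (a, b))"
    by (intro sum.cong refl) (use C ab F\<sigma> in \<open>auto simp: mult_ac carrier_matD[OF C]\<close>)
  finally show ?thesis .
qed

lemma linear_on_mats_comp:
  "linear_on_mats n F \<Longrightarrow> linear_on_mats n G \<Longrightarrow> linear_on_mats n (F \<circ> G)"
  by (simp add: linear_on_mats_def)

lemma linear_on_mats_id: "linear_on_mats n id"
  by (simp add: linear_on_mats_def)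

lemma pauli_map_comp:
  assumes "pauli_map F \<sigma> L" "pauli_map G \<sigma> M"
  shows "pauli_map (F \<circ> G) \<sigma> (\<lambda>j. L j * M j)"
proof -
  have "(F \<circ> G) (\<sigma> j) = complex_of_real (L j * M j) \<cdot>\<^sub>m \<sigma> j" if "j < 4" for j
  proof -
    have "\<sigma> j \<in> carrier_mat 2 2" using assms that pauli_basis_carrier by (auto simp: pauli_map_def)
    then have "(F \<circ> G) (\<sigma> j) = complex_of_real (M j) \<cdot>\<^sub>m (complex_of_real (L j) \<cdot>\<^sub>m \<sigma> j)"
      using assms that by (auto simp: pauli_map_def linear_on_mats_def)
    then show ?thesis by (auto simp: mult_ac intro!: eq_matI)
  qed
  then show ?thesis
    using assms by (simp add: pauli_map_def linear_on_mats_comp)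
qed

lemma pauli_map_id: "pauli_basis \<sigma> \<Longrightarrow> pauli_map id \<sigma> (\<lambda>_. 1)"
  by (auto simp: pauli_map_def linear_on_mats_id)

section \<open>The singlet state\<close>

text \<open>A rank-one decomposition of \<open>A\<close> turns the trace into a sum of values of the
  quadratic form of \<open>B\<close>.\<close>

lemma mat_trace_mult_nonneg:
  assumes A: "pos_semidef n A" and B: "pos_semidef n B"
  shows "0 \<le> Re (mat_trace (A * B))"
proof -
  obtain v where v: "\<And>a b. a < n \<Longrightarrow> b < n \<Longrightarrow> A $$ (a, b) = (\<Sum>l<n. v l a * cnj (v l b))"
    using pos_semidef_rank_one_sum[OF A] by blast
  have "mat_trace (A * B) = (\<Sum>a<n. \<Sum>b<n. \<Sum>l<n. B $$ (b, a) * v l a * cnj (v l b))"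
    unfolding mat_trace_mult[OF A[THEN pos_semidef_carrier] B[THEN pos_semidef_carrier]]
    by (intro sum.cong refl) (simp add: v sum_distrib_left sum_distrib_right mult_ac)
  also have "\<dots> = (\<Sum>b<n. \<Sum>a<n. \<Sum>l<n. B $$ (b, a) * v l a * cnj (v l b))"
    by (rule sum.swap)
  also have "\<dots> = (\<Sum>b<n. \<Sum>l<n. \<Sum>a<n. B $$ (b, a) * v l a * cnj (v l b))"
    by (intro sum.cong refl sum.swap)
  also have "\<dots> = (\<Sum>l<n. \<Sum>b<n. \<Sum>a<n. B $$ (b, a) * v l a * cnj (v l b))"
    by (rule sum.swap)
  finally have tr: "Re (mat_trace (A * B)) = (\<Sum>l<n. Re (\<Sum>b<n. \<Sum>a<n. B $$ (b, a) * v l a * cnj (v l b)))"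
    by (simp only: Re_sum)
  show ?thesis
    unfolding tr using B unfolding pos_semidef_iff by (intro sum_nonneg) blast
qed

text \<open>The trace of \<open>X\<close> against the swap operator. It maps \<open>A \<otimes> B\<close> to the trace of \<open>A * B\<close>,
  so it is nonnegative on separable matrices, while it is \<open>-1\<close> on the singlet state.\<close>

definition swap_trace :: "complex mat \<Rightarrow> complex" where
  "swap_trace X = (\<Sum>a<2. \<Sum>b<2. X $$ (a * 2 + b, b * 2 + a))"

lemma swap_trace_msum_tensor:
  assumes "\<And>s. s \<in> S \<Longrightarrow> A s \<in> carrier_mat 2 2" "\<And>s. s \<in> S \<Longrightarrow> B s \<in> carrier_mat 2 2"
  shows "swap_trace (msum (2 * 2) (\<lambda>s. c s \<cdot>\<^sub>m mat_tensor (A s) (B s)) S) =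
    (\<Sum>s\<in>S. c s * mat_trace (A s * B s))"
proof -
  have lt: "a * 2 + b < 2 * 2" if "a < 2" "b < 2" for a b :: nat
    using that by (rule index_less_mult)
  have "swap_trace (msum (2 * 2) (\<lambda>s. c s \<cdot>\<^sub>m mat_tensor (A s) (B s)) S) =
      (\<Sum>a<2. \<Sum>b<2. \<Sum>s\<in>S. c s * (A s $$ (a, b) * B s $$ (b, a)))"
    unfolding swap_trace_def
  proof (intro sum.cong refl)
    fix a b :: nat assume "a \<in> {..<2}" "b \<in> {..<2}"
    then have ab: "a < 2" "b < 2" by simp_all
    have "msum (2 * 2) (\<lambda>s. c s \<cdot>\<^sub>m mat_tensor (A s) (B s)) S $$ (a * 2 + b, b * 2 + a) =
        (\<Sum>s\<in>S. (c s \<cdot>\<^sub>m mat_tensor (A s) (B s)) $$ (a * 2 + b, b * 2 + a))"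
      using lt[OF ab] lt[OF ab(2,1)] by (simp add: msum_def)
    also have "\<dots> = (\<Sum>s\<in>S. c s * (A s $$ (a, b) * B s $$ (b, a)))"
    proof (rule sum.cong[OF refl])
      fix s assume s: "s \<in> S"
      show "(c s \<cdot>\<^sub>m mat_tensor (A s) (B s)) $$ (a * 2 + b, b * 2 + a) = c s * (A s $$ (a, b) * B s $$ (b, a))"
        using lt[OF ab] lt[OF ab(2,1)] ab
          mat_tensor_entry[OF assms[OF s] lt[OF ab] lt[OF ab(2,1)]]
          carrier_matD[OF assms(1)[OF s]] carrier_matD[OF assms(2)[OF s]]
        by simp
    qed
    finally show "msum (2 * 2) (\<lambda>s. c s \<cdot>\<^sub>m mat_tensor (A s) (B s)) S $$ (a * 2 + b, b * 2 + a) =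
        (\<Sum>s\<in>S. c s * (A s $$ (a, b) * B s $$ (b, a)))" .
  qed
  also have "\<dots> = (\<Sum>s\<in>S. \<Sum>a<2. \<Sum>b<2. c s * (A s $$ (a, b) * B s $$ (b, a)))"
    by (simp add: sum_lessThan_2 sum.distrib)
  also have "\<dots> = (\<Sum>s\<in>S. c s * mat_trace (A s * B s))"
    by (intro sum.cong refl) (simp add: mat_trace_mult[OF assms] sum_distrib_left)
  finally show ?thesis .
qed

lemma swap_trace_separable:
  assumes "separable 2 2 X"
  shows "0 \<le> Re (swap_trace X)"
proof -
  obtain N p \<alpha> \<beta> where st: "\<forall>k<(N::nat). 0 \<le> p k \<and> is_state 2 (\<alpha> k) \<and> is_state 2 (\<beta> k)"
    and X: "X = msum (2 * 2) (\<lambda>k. complex_of_real (p k) \<cdot>\<^sub>m mat_tensor (\<alpha> k) (\<beta> k)) {..<N}"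
    using assms unfolding separable_def by blast
  have psd: "pos_semidef 2 (\<alpha> k)" "pos_semidef 2 (\<beta> k)" if "k < N" for k
    using st that by (auto simp: is_state_def)
  have "swap_trace X = (\<Sum>k<N. complex_of_real (p k) * mat_trace (\<alpha> k * \<beta> k))"
    unfolding X by (rule swap_trace_msum_tensor) (use psd in \<open>auto intro: pos_semidef_carrier\<close>)
  also have "Re \<dots> = (\<Sum>k<N. p k * Re (mat_trace (\<alpha> k * \<beta> k)))"
    by simp
  also have "\<dots> \<ge> 0"
    using st psd by (intro sum_nonneg mult_nonneg_nonneg mat_trace_mult_nonneg) auto
  finally show ?thesis .
qed

text \<open>The projector onto (e_0 \<otimes> e_1 - e_1 \<otimes> e_0) / sqrt 2: these two product
  vectors have the indices 1 and 2.\<close>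

definition singlet :: "complex mat" where
  "singlet = mat 4 4 (\<lambda>(x, y). ((if x = 1 then 1 else 0) - (if x = 2 then 1 else 0)) *
      ((if y = 1 then 1 else 0) - (if y = 2 then 1 else 0)) / 2)"

lemma singlet_state: "is_state (2 * 2) singlet"
proof -
  have psd: "0 \<le> Re (\<Sum>a<4. \<Sum>b<4. singlet $$ (a, b) * x b * cnj (x a))" for x
  proof -
    have "(\<Sum>a<4. \<Sum>b<4. singlet $$ (a, b) * x b * cnj (x a)) = (x 1 - x 2) * cnj (x 1 - x 2) / 2"
      by (simp add: sum_lessThan_4 singlet_def field_simps)
    also have "\<dots> = complex_of_real ((cmod (x 1 - x 2))\<^sup>2 / 2)"
      by (simp only: complex_norm_square of_real_divide of_real_numeral)
    finally show ?thesis by (simp only: Re_complex_of_real) simp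
  qed
  have herm: "\<forall>a<4. \<forall>b<4. singlet $$ (b, a) = cnj (singlet $$ (a, b))"
    by (simp add: singlet_def)
  have "pos_semidef 4 singlet"
    unfolding pos_semidef_iff
    by (intro conjI, simp add: singlet_def, rule herm, rule allI, rule psd)
  moreover have "mat_trace singlet = 1"
    by (simp add: mat_trace_def sum_lessThan_4 singlet_def)
  ultimately show ?thesis by (simp add: is_state_def)
qed

text \<open>The singlet is (1 - swap) / 2, and by completeness the swap is half the sum of
  \<open>\<sigma> j\<close> \<otimes> \<open>\<sigma> j\<close>, in whatever Pauli basis. Hence the
  basis that diagonalises the channel may be used.\<close>

lemma singlet_pauli:
  assumes \<sigma>: "pauli_basis \<sigma>"
  shows "singlet = msum (2 * 2) (\<lambda>j. (if j = 0 then 1 / 4 else - 1 / 4) \<cdot>\<^sub>m mat_tensor (\<sigma> j) (\<sigma> j)) {..<4}"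
    (is "_ = msum _ ?f _")
proof (rule eq_matI)
  fix x y assume "x < dim_row (msum (2 * 2) ?f {..<4})" "y < dim_col (msum (2 * 2) ?f {..<4})"
  then have xy: "x < 2 * 2" "y < 2 * 2" by (simp_all add: msum_def)
  note q = div_mod_less_mult[OF xy(1)] div_mod_less_mult[OF xy(2)]
  note C = pauli_basis_carrier[OF \<sigma>]
  let ?s = "\<lambda>j. \<sigma> j $$ (x div 2, y div 2) * \<sigma> j $$ (x mod 2, y mod 2)"
  have \<sigma>0: "\<sigma> 0 = 1\<^sub>m 2" using \<sigma> by (simp add: pauli_basis_def)
  have "msum (2 * 2) ?f {..<4} $$ (x, y) = (\<Sum>j<4. (if j = 0 then 1 / 4 else - 1 / 4) * ?s j)"
    using xy mat_tensor_entry[OF C C xy] carrier_matD[OF C]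
    by (simp add: msum_def)
  also have "\<dots> = ?s 0 / 2 - (\<Sum>j<4. ?s j) / 4"
    by (simp add: sum_lessThan_4 field_simps)
  also have "\<dots> = (if x div 2 = y div 2 \<and> x mod 2 = y mod 2 then 1 / 2 else 0) -
      (if x div 2 = y mod 2 \<and> y div 2 = x mod 2 then 1 / 2 else 0)"
    using q unfolding pauli_basis_completeness[OF \<sigma> q(1,3,2,4)] by (simp add: \<sigma>0)
  also have "\<dots> = singlet $$ (x, y)"
  proof -
    have "x \<in> {0, 1, 2, 3}" "y \<in> {0, 1, 2, 3}" using xy by auto
    then show ?thesis by (elim insertE emptyE) (simp_all add: singlet_def)
  qed
  finally show "singlet $$ (x, y) = msum (2 * 2) ?f {..<4} $$ (x, y)" ..
qed (simp_all add: msum_def singlet_def)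

text \<open>The swap trace of the output is half of 1 minus the left-hand side. Two different maps
  are allowed so that one computation serves E \<otimes> E (with \<open>M = L\<close>) and E^2
  \<otimes> id (with \<open>M = 1\<close>).\<close>

lemma pauli_map_separable_singlet:
  assumes F: "pauli_map F \<sigma> L" and G: "pauli_map G \<sigma> M"
    and sep: "separable 2 2 (map_tensor 2 2 F G singlet)"
  shows "L 1 * M 1 + L 2 * M 2 + L 3 * M 3 \<le> 1"
proof -
  have \<sigma>: "pauli_basis \<sigma>" and lin: "linear_on_mats 2 F" "linear_on_mats 2 G"
    using F G by (auto simp: pauli_map_def)
  note C = pauli_basis_carrier[OF \<sigma>]
  let ?w = "\<lambda>j::nat. if j = 0 then 1 / 4 else - 1 / 4 :: complex"
  have tr: "mat_trace (F (\<sigma> j) * G (\<sigma> j)) = complex_of_real (2 * (L j * M j))" if j: "j < 4" for j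
  proof -
    have "mat_trace (F (\<sigma> j) * G (\<sigma> j)) = complex_of_real (L j * M j) * mat_trace (\<sigma> j * \<sigma> j)"
      using F G j C[OF j] unfolding pauli_map_def
      by (simp add: mat_trace_mult[of _ 2] sum_distrib_left mult_ac)
    then show ?thesis using \<sigma> j by (simp add: pauli_basis_def)
  qed
  have "map_tensor 2 2 F G singlet = msum (2 * 2) (\<lambda>j. ?w j \<cdot>\<^sub>m mat_tensor (F (\<sigma> j)) (G (\<sigma> j))) {..<4}"
    unfolding singlet_pauli[OF \<sigma>] using C by (intro map_tensor_tensor_sum[OF lin]) auto
  then have "swap_trace (map_tensor 2 2 F G singlet) = (\<Sum>j<4. ?w j * mat_trace (F (\<sigma> j) * G (\<sigma> j)))"
    using C linear_on_mats_carrier[OF lin(1)] linear_on_mats_carrier[OF lin(2)]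
    by (simp only:) (intro swap_trace_msum_tensor, auto)
  also have "\<dots> = complex_of_real (L 0 * M 0 / 2 - (L 1 * M 1 + L 2 * M 2 + L 3 * M 3) / 2)"
    by (simp add: sum_lessThan_4 tr field_simps)
  finally show ?thesis
    using swap_trace_separable[OF sep] F G by (simp add: pauli_map_def)
qed

section \<open>Measure-and-prepare maps\<close>

text \<open>A traceless self-adjoint \<open>A\<close> has the eigenvalues +sqrt(t/2) and -sqrt(t/2),
  so the hypothesis on \<open>c\<close> bounds those of \<open>c A\<close> by 1 in modulus. The
  proof uses the determinant and the diagonal instead of eigenvalues.\<close>

lemma pos_semidef_one_plus:
  assumes A: "self_adjoint 2 A" "mat_trace A = 0" "mat_trace (A * A) = complex_of_real t"
    and c: "c\<^sup>2 * t \<le> 2"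
  shows "pos_semidef 2 (1\<^sub>m 2 + complex_of_real c \<cdot>\<^sub>m A)"
proof -
  have C: "A \<in> carrier_mat 2 2" using A(1) by (simp add: self_adjoint_def)
  have herm: "\<And>a b. a < 2 \<Longrightarrow> b < 2 \<Longrightarrow> A $$ (b, a) = cnj (A $$ (a, b))"
    using A(1) unfolding self_adjoint_iff by blast
  define z w where "z = Re (A $$ (0, 0))" and "w = A $$ (0, Suc 0)"
  have A00: "A $$ (0, 0) = complex_of_real z"
    using herm[of 0 0] unfolding z_def by (metis Reals_cnj_iff of_real_Re pos2)
  have A10: "A $$ (Suc 0, 0) = cnj w" using herm[of 0 1] by (simp add: w_def)
  have A11: "A $$ (Suc 0, Suc 0) = complex_of_real (- z)"
    using A(2) C A00 by (simp add: mat_trace_def sum_lessThan_2 add_eq_0_iff)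
  have "complex_of_real (2 * z\<^sup>2 + 2 * (cmod w)\<^sup>2) = complex_of_real t"
    using A(3) complex_norm_square[of w] unfolding mat_trace_mult[OF C C]
    by (simp add: sum_lessThan_2 A00 A10 A11 w_def[symmetric] power2_eq_square mult.commute add.commute)
  then have t: "2 * z\<^sup>2 + 2 * (cmod w)\<^sup>2 = t" by (simp only: of_real_eq_iff)
  define P Q where "P = 1 + c * z" and "Q = 1 - c * z"
  \<comment> \<open>The determinant is nonnegative, since \<open>t\<close> is twice the sum of the
    squared moduli of \<open>z\<close> and \<open>w\<close>.\<close>
  have wPQ: "(c * cmod w)\<^sup>2 \<le> P * Q"
    using c unfolding t[symmetric] P_def Q_def by (simp add: algebra_simps power2_eq_square)
  have "(c * z)\<^sup>2 \<le> 1" using wPQ zero_le_power2[of "c * cmod w"]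
    unfolding P_def Q_def by (simp add: algebra_simps power2_eq_square)
  then have "\<bar>c * z\<bar> \<le> 1" by (simp add: abs_square_le_1)
  then have PQ: "0 \<le> P" "0 \<le> Q" by (auto simp: P_def Q_def)
  show ?thesis
    unfolding pos_semidef_iff
  proof (intro conjI allI impI)
    show "1\<^sub>m 2 + complex_of_real c \<cdot>\<^sub>m A \<in> carrier_mat 2 2" using C by simp
    fix a b :: nat assume ab: "a < 2" "b < 2"
    show "(1\<^sub>m 2 + complex_of_real c \<cdot>\<^sub>m A) $$ (b, a) = cnj ((1\<^sub>m 2 + complex_of_real c \<cdot>\<^sub>m A) $$ (a, b))"
      using ab C herm[OF ab] by simp
  next
    fix x :: "nat \<Rightarrow> complex"
    define X Y where "X = cmod (x 0)" and "Y = cmod (x 1)"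
    have "(\<Sum>a<2. \<Sum>b<2. (1\<^sub>m 2 + complex_of_real c \<cdot>\<^sub>m A) $$ (a, b) * x b * cnj (x a)) =
        complex_of_real P * (x 0 * cnj (x 0)) + complex_of_real Q * (x 1 * cnj (x 1)) +
        complex_of_real c * (w * x 1 * cnj (x 0) + cnj (w * x 1 * cnj (x 0)))"
      using C A00 A10 A11 by (simp add: sum_lessThan_2 P_def Q_def w_def[symmetric] algebra_simps)
    also have "\<dots> = complex_of_real (P * X\<^sup>2 + Q * Y\<^sup>2 + c * (2 * Re (w * x 1 * cnj (x 0))))"
      unfolding complex_norm_square[symmetric] complex_add_cnj X_def Y_def by simp
    finally have form: "Re (\<Sum>a<2. \<Sum>b<2. (1\<^sub>m 2 + complex_of_real c \<cdot>\<^sub>m A) $$ (a, b) * x b * cnj (x a)) =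
        P * X\<^sup>2 + Q * Y\<^sup>2 + c * (2 * Re (w * x 1 * cnj (x 0)))"
      by simp
    have "\<bar>c * (2 * Re (w * x 1 * cnj (x 0)))\<bar> \<le> \<bar>c\<bar> * (2 * cmod (w * x 1 * cnj (x 0)))"
      using abs_Re_le_cmod[of "w * x 1 * cnj (x 0)"] by (simp add: abs_mult mult_left_mono)
    also have "\<dots> = 2 * \<bar>c * cmod w\<bar> * (X * Y)"
      by (simp add: X_def Y_def norm_mult abs_mult)
    \<comment> \<open>Comparison of squares: the determinant bound, followed by the inequality of
      arithmetic and geometric means.\<close>
    also have "\<dots> \<le> P * X\<^sup>2 + Q * Y\<^sup>2"
    proof (rule power2_le_imp_le)
      have "(2 * \<bar>c * cmod w\<bar> * (X * Y))\<^sup>2 = 4 * (c * cmod w)\<^sup>2 * (X * Y)\<^sup>2"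
        by (simp add: power_mult_distrib)
      also have "\<dots> \<le> 4 * (P * Q) * (X * Y)\<^sup>2"
        using wPQ by (intro mult_right_mono mult_left_mono) auto
      also have "\<dots> \<le> (P * X\<^sup>2 + Q * Y\<^sup>2)\<^sup>2"
        using zero_le_power2[of "P * X\<^sup>2 - Q * Y\<^sup>2"] by (simp add: algebra_simps power2_eq_square)
      finally show "(2 * \<bar>c * cmod w\<bar> * (X * Y))\<^sup>2 \<le> (P * X\<^sup>2 + Q * Y\<^sup>2)\<^sup>2" .
    qed (use PQ in simp)
    finally show "0 \<le> Re (\<Sum>a<2. \<Sum>b<2. (1\<^sub>m 2 + complex_of_real c \<cdot>\<^sub>m A) $$ (a, b) * x b * cnj (x a))"
      unfolding form by linarith
  qed
qed

text \<open>The partial trace of \<open>(M \<otimes> 1) * \<rho>\<close> over the first factor: the unnormalised state of the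
  second system after the outcome \<open>M\<close> is measured on the first one.\<close>

definition partial_measure :: "nat \<Rightarrow> nat \<Rightarrow> complex mat \<Rightarrow> complex mat \<Rightarrow> complex mat" where
  "partial_measure n m M \<rho> =
     mat m m (\<lambda>(a, b). \<Sum>i<n. \<Sum>j<n. M $$ (j, i) * \<rho> $$ (i * m + a, j * m + b))"

text \<open>If \<open>M\<close> is the sum of the rank-one operators of \<open>f l\<close>, the form
  at \<open>x\<close> is the sum over \<open>l\<close> of the form of \<open>\<rho>\<close> at
  \<open>f l\<close> \<otimes> \<open>x\<close>, written \<open>z l\<close> below.\<close>

lemma pos_semidef_partial_measure:
  assumes M: "pos_semidef n M" and \<rho>: "pos_semidef (n * m) \<rho>"
  shows "pos_semidef m (partial_measure n m M \<rho>)"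
  unfolding pos_semidef_iff
proof (intro conjI allI impI)
  show "partial_measure n m M \<rho> \<in> carrier_mat m m"
    by (simp add: partial_measure_def)
  have herm: "M $$ (j, i) = cnj (M $$ (i, j))" if "i < n" "j < n" for i j
    using M that unfolding pos_semidef_iff by blast
  have herm': "\<rho> $$ (j, i) = cnj (\<rho> $$ (i, j))" if "i < n * m" "j < n * m" for i j
    using \<rho> that unfolding pos_semidef_iff by blast
  fix a b assume ab: "a < m" "b < m"
  have "(\<Sum>i<n. \<Sum>j<n. M $$ (j, i) * \<rho> $$ (i * m + b, j * m + a)) =
      (\<Sum>i<n. \<Sum>j<n. cnj (M $$ (i, j) * \<rho> $$ (j * m + a, i * m + b)))"
  proof (intro sum.cong refl)
    fix i j assume "i \<in> {..<n}" "j \<in> {..<n}"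
    then have "i < n" "j < n" by simp_all
    then show "M $$ (j, i) * \<rho> $$ (i * m + b, j * m + a) = cnj (M $$ (i, j) * \<rho> $$ (j * m + a, i * m + b))"
      using herm[of i j] herm'[of "j * m + a" "i * m + b"] ab by (simp add: index_less_mult)
  qed
  also have "\<dots> = (\<Sum>j<n. \<Sum>i<n. cnj (M $$ (i, j) * \<rho> $$ (j * m + a, i * m + b)))"
    by (rule sum.swap)
  finally show "partial_measure n m M \<rho> $$ (b, a) = cnj (partial_measure n m M \<rho> $$ (a, b))"
    using ab by (simp add: partial_measure_def)
next
  fix x
  obtain f where f: "\<And>a b. a < n \<Longrightarrow> b < n \<Longrightarrow> M $$ (a, b) = (\<Sum>l<n. f l a * cnj (f l b))"
    using pos_semidef_rank_one_sum[OF M] by blast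
  define z where "z l I = f l (I div m) * x (I mod m)" for l I
  have form: "(\<Sum>I<n * m. \<Sum>J<n * m. \<rho> $$ (I, J) * z l J * cnj (z l I)) =
      (\<Sum>i<n. \<Sum>a<m. \<Sum>j<n. \<Sum>b<m. \<rho> $$ (i * m + a, j * m + b) * (f l j * x b) * cnj (f l i * x a))" for l
  proof -
    have inner: "(\<Sum>J<n * m. \<rho> $$ (I, J) * z l J * c) =
        (\<Sum>j<n. \<Sum>b<m. \<rho> $$ (I, j * m + b) * (f l j * x b) * c)" for I c
      using sum_lessThan_mult[of "\<lambda>j b. \<rho> $$ (I, j * m + b) * (f l j * x b) * c" m n]
      by (simp add: z_def)
    show ?thesis
      unfolding inner
      using sum_lessThan_mult[of "\<lambda>i a. \<Sum>j<n. \<Sum>b<m. \<rho> $$ (i * m + a, j * m + b) * (f l j * x b) * cnj (f l i * x a)" m n]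
      by (simp add: z_def)
  qed
  have "(\<Sum>a<m. \<Sum>b<m. partial_measure n m M \<rho> $$ (a, b) * x b * cnj (x a)) =
      (\<Sum>a<m. \<Sum>b<m. \<Sum>i<n. \<Sum>j<n. \<Sum>l<n. \<rho> $$ (i * m + a, j * m + b) * (f l j * x b) * cnj (f l i * x a))"
    by (intro sum.cong refl)
      (simp add: partial_measure_def f sum_distrib_left sum_distrib_right mult_ac)
  also have "\<dots> = (\<Sum>(a, b, i, j, l)\<in>{..<m} \<times> {..<m} \<times> {..<n} \<times> {..<n} \<times> {..<n}.
      \<rho> $$ (i * m + a, j * m + b) * (f l j * x b) * cnj (f l i * x a))"
    by (simp add: sum.cartesian_product)
  also have "\<dots> = (\<Sum>(l, i, a, j, b)\<in>{..<n} \<times> {..<n} \<times> {..<m} \<times> {..<n} \<times> {..<m}.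
      \<rho> $$ (i * m + a, j * m + b) * (f l j * x b) * cnj (f l i * x a))"
    by (rule sum.reindex_bij_witness[of _ "\<lambda>(l, i, a, j, b). (a, b, i, j, l)" "\<lambda>(a, b, i, j, l). (l, i, a, j, b)"])
      auto
  also have "\<dots> = (\<Sum>l<n. \<Sum>I<n * m. \<Sum>J<n * m. \<rho> $$ (I, J) * z l J * cnj (z l I))"
    unfolding form by (simp add: sum.cartesian_product)
  finally have eq: "Re (\<Sum>a<m. \<Sum>b<m. partial_measure n m M \<rho> $$ (a, b) * x b * cnj (x a)) =
      (\<Sum>l<n. Re (\<Sum>I<n * m. \<Sum>J<n * m. \<rho> $$ (I, J) * z l J * cnj (z l I)))"
    by (simp only: Re_sum)
  show "0 \<le> Re (\<Sum>a<m. \<Sum>b<m. partial_measure n m M \<rho> $$ (a, b) * x b * cnj (x a))"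
    unfolding eq using \<rho> unfolding pos_semidef_iff by (intro sum_nonneg) blast
qed

text \<open>The hypothesis says that \<open>F\<close> is the measure-and-prepare map
  \<open>X \<mapsto> \<Sum>k. tr (M k * X) \<cdot> R k\<close>.\<close>

lemma measure_and_prepare_sep_cone:
  assumes F: "linear_on_mats n F" and K: "finite K"
    and M: "\<And>k. k \<in> K \<Longrightarrow> pos_semidef n (M k)" and R: "\<And>k. k \<in> K \<Longrightarrow> pos_semidef n (R k)"
    and FMR: "\<And>i j a b. i < n \<Longrightarrow> j < n \<Longrightarrow> a < n \<Longrightarrow> b < n \<Longrightarrow>
      F (mat_unit n i j) $$ (a, b) = (\<Sum>k\<in>K. M k $$ (j, i) * R k $$ (a, b))"
    and \<rho>: "pos_semidef (n * m) \<rho>"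
  shows "map_tensor n m F id \<rho> \<in> sep_cone n m"
proof -
  let ?T = "\<lambda>k. mat_tensor (R k) (partial_measure n m (M k) \<rho>)"
  have P: "pos_semidef m (partial_measure n m (M k) \<rho>)" if "k \<in> K" for k
    using M[OF that] \<rho> by (rule pos_semidef_partial_measure)
  \<comment> \<open>Outcome \<open>k\<close> leaves \<open>R k\<close> on the first system and the
    partially measured operator on the second; the identity map on the ancilla picks out a single
    matrix unit.\<close>
  have "map_tensor n m F id \<rho> = msum (n * m) ?T K"
  proof (rule eq_matI)
    fix a b assume "a < dim_row (msum (n * m) ?T K)" "b < dim_col (msum (n * m) ?T K)"
    then have ab: "a < n * m" "b < n * m" by (simp_all add: msum_def)
    note q = div_mod_less_mult[OF ab(1)] div_mod_less_mult[OF ab(2)]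
    have unit: "mat_unit m k l $$ (a mod m, b mod m) = (if k = a mod m \<and> l = b mod m then 1 else 0)" for k l
      using q by (auto simp: mat_unit_def)
    have "map_tensor n m F id \<rho> $$ (a, b) =
        (\<Sum>i<n. \<Sum>j<n. \<Sum>k<m. \<Sum>l<m. \<rho> $$ (i * m + k, j * m + l) *
          (F (mat_unit n i j) $$ (a div m, b div m) * mat_unit m k l $$ (a mod m, b mod m)))"
      unfolding map_tensor_entry[OF F linear_on_mats_id ab] by (simp add: sum.cartesian_product)
    also have "\<dots> = (\<Sum>i<n. \<Sum>j<n. \<rho> $$ (i * m + a mod m, j * m + b mod m) *
          F (mat_unit n i j) $$ (a div m, b div m))"
    proof (intro sum.cong refl)
      fix i j
      let ?g = "\<lambda>k l. \<rho> $$ (i * m + k, j * m + l) * F (mat_unit n i j) $$ (a div m, b div m)"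
      have "(\<Sum>k<m. \<Sum>l<m. \<rho> $$ (i * m + k, j * m + l) *
          (F (mat_unit n i j) $$ (a div m, b div m) * mat_unit m k l $$ (a mod m, b mod m))) =
        (\<Sum>k<m. if k = a mod m then \<Sum>l<m. if l = b mod m then ?g k l else 0 else 0)"
        by (intro sum.cong refl) (auto simp: unit simp del: sum.delta sum.delta' intro!: sum.cong)
      also have "\<dots> = ?g (a mod m) (b mod m)" using q by simp
      finally show "(\<Sum>k<m. \<Sum>l<m. \<rho> $$ (i * m + k, j * m + l) *
          (F (mat_unit n i j) $$ (a div m, b div m) * mat_unit m k l $$ (a mod m, b mod m))) =
          ?g (a mod m) (b mod m)" .
    qed
    also have "\<dots> = (\<Sum>i<n. \<Sum>j<n. \<Sum>k\<in>K. R k $$ (a div m, b div m) *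
          (M k $$ (j, i) * \<rho> $$ (i * m + a mod m, j * m + b mod m)))"
      using q by (intro sum.cong refl) (simp add: FMR sum_distrib_left mult_ac)
    also have "\<dots> = (\<Sum>i<n. \<Sum>k\<in>K. \<Sum>j<n. R k $$ (a div m, b div m) *
          (M k $$ (j, i) * \<rho> $$ (i * m + a mod m, j * m + b mod m)))"
      by (intro sum.cong refl sum.swap)
    also have "\<dots> = (\<Sum>k\<in>K. \<Sum>i<n. \<Sum>j<n. R k $$ (a div m, b div m) *
          (M k $$ (j, i) * \<rho> $$ (i * m + a mod m, j * m + b mod m)))"
      by (rule sum.swap)
    also have "\<dots> = (\<Sum>k\<in>K. ?T k $$ (a, b))"
      using q mat_tensor_entry[OF R[THEN pos_semidef_carrier] P[THEN pos_semidef_carrier] ab]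
      by (intro sum.cong refl) (simp add: partial_measure_def sum_distrib_left)
    finally show "map_tensor n m F id \<rho> $$ (a, b) = msum (n * m) ?T K $$ (a, b)"
      using ab by (simp add: msum_def)
  qed (simp_all add: msum_def map_tensor_def)
  moreover have "msum (n * m) ?T K \<in> sep_cone n m"
    using K R P by (intro sep_cone_msum sep_cone_tensor) auto
  ultimately show ?thesis by simp
qed

lemma pauli_basis_trace:
  assumes \<sigma>: "pauli_basis \<sigma>" and j: "j < 4" and j0: "j \<noteq> 0"
  shows "mat_trace (\<sigma> j) = 0"
proof -
  have "\<forall>j<4. \<forall>k<4. mat_trace (\<sigma> j * \<sigma> k) = (if j = k then 2 else 0)"
    using \<sigma> unfolding pauli_basis_def by (elim conjE)
  from this[rule_format, of 0 j] have "mat_trace (\<sigma> 0 * \<sigma> j) = 0"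
    using j j0 by simp
  moreover have "\<sigma> 0 * \<sigma> j = \<sigma> j"
    using \<sigma> pauli_basis_carrier[OF \<sigma> j] by (simp add: pauli_basis_def)
  ultimately show ?thesis by simp
qed

text \<open>For \<open>j > 0\<close> the criterion above applies with \<open>t = 2\<close> and reads
  \<open>c^2 \<le> 1\<close>. The identity \<open>\<sigma> 0\<close> is not traceless and is treated
  as a multiple of 1; that 1 itself is positive is the criterion for the zero matrix.\<close>

lemma pauli_basis_one_plus:
  assumes \<sigma>: "pauli_basis \<sigma>" and j: "j < 4" and c: "\<bar>c\<bar> \<le> 1"
  shows "pos_semidef 2 (1\<^sub>m 2 + complex_of_real c \<cdot>\<^sub>m \<sigma> j)"
proof (cases "j = 0")
  case True
  have z: "self_adjoint 2 (0\<^sub>m 2 2)" by (simp add: self_adjoint_iff)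
  have "pos_semidef 2 (1\<^sub>m 2 + complex_of_real 0 \<cdot>\<^sub>m 0\<^sub>m 2 2)"
    by (rule pos_semidef_one_plus[OF z, of 0]) (simp_all add: mat_trace_def)
  moreover have "1\<^sub>m 2 + complex_of_real 0 \<cdot>\<^sub>m 0\<^sub>m 2 2 = (1\<^sub>m 2 :: complex mat)" by auto
  ultimately have "pos_semidef 2 (complex_of_real (1 + c) \<cdot>\<^sub>m 1\<^sub>m 2)"
    using c by (intro pos_semidef_smult) auto
  moreover have "complex_of_real (1 + c) \<cdot>\<^sub>m 1\<^sub>m 2 = 1\<^sub>m 2 + complex_of_real c \<cdot>\<^sub>m \<sigma> j"
    using \<sigma> True by (auto simp: pauli_basis_def)
  ultimately show ?thesis by simp
next
  case False
  have \<sigma>j: "self_adjoint 2 (\<sigma> j)" and tr: "mat_trace (\<sigma> j * \<sigma> j) = complex_of_real 2"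
    using \<sigma> j by (simp_all add: pauli_basis_def)
  have "mat_trace (\<sigma> j) = 0" using pauli_basis_trace[OF \<sigma> j] False by simp
  moreover have "c\<^sup>2 * 2 \<le> 2" using c by (simp add: abs_square_le_1)
  ultimately show ?thesis using pos_semidef_one_plus[OF \<sigma>j _ tr] by blast
qed

text \<open>Measuring along \<open>\<sigma> j\<close> and preparing the operator of the outcome
  reproduces the \<open>\<sigma> j\<close> component together with a multiple of the identity
  component. The bound on the sum leaves a nonnegative weight for the rest of the latter.\<close>

lemma pauli_map_entanglement_breaking:
  assumes F: "pauli_map F \<sigma> L" "trace_preserving 2 F"
    and L: "\<And>j. j < 4 \<Longrightarrow> 0 \<le> L j" and sum_le: "L 1 + L 2 + L 3 \<le> 1"
  shows "entanglement_breaking 2 F"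
  unfolding entanglement_breaking_def
proof (intro allI impI)
  fix m \<rho> assume \<rho>: "is_state (2 * m) \<rho>"
  have \<sigma>: "pauli_basis \<sigma>" and lin: "linear_on_mats 2 F" and L0: "L 0 = 1"
    using F by (auto simp: pauli_map_def)
  note C = pauli_basis_carrier[OF \<sigma>]
  \<comment> \<open>The two signs together give 2 c_j (1 \<otimes> 1 + \<sigma>_j \<otimes>
    \<sigma>_j), so c_j = L_j / 4 yields the required coefficient L_j / 2. For \<open>j = 0\<close>
    this is 4 c_0 (1 \<otimes> 1), because the sign -1 gives the zero operator; it must supply the
    missing (1 - L_1 - L_2 - L_3) / 2.\<close>
  define c where "c j = (if j = 0 then 1 - L 1 - L 2 - L 3 else 2 * L j) / 8" for j
  define M where "M = (\<lambda>(j, s). 1\<^sub>m 2 + complex_of_real s \<cdot>\<^sub>m \<sigma> j)"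
  define R where "R = (\<lambda>(j, s). complex_of_real (c j) \<cdot>\<^sub>m M (j, s))"
  let ?K = "{..<4} \<times> {1, - 1 :: real}"
  have M: "pos_semidef 2 (M k)" if "k \<in> ?K" for k
    using that \<sigma> by (auto simp: M_def intro!: pauli_basis_one_plus[of _ _ 1, simplified] pauli_basis_one_plus[of _ _ "-1", simplified])
  have "0 \<le> c j" if "j < 4" for j
    using L[OF that] sum_le by (simp add: c_def)
  with M have R: "pos_semidef 2 (R k)" if "k \<in> ?K" for k
    using that by (auto simp: R_def intro!: pos_semidef_smult)
  have \<sigma>0: "\<sigma> 0 = 1\<^sub>m 2" using \<sigma> by (simp add: pauli_basis_def)
  have FMR: "F (mat_unit 2 i k) $$ (a, b) = (\<Sum>p\<in>?K. M p $$ (k, i) * R p $$ (a, b))"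
    if "i < 2" "k < 2" "a < 2" "b < 2" for i k a b
  proof -
    let ?I = "\<lambda>i j. (1\<^sub>m 2 :: complex mat) $$ (i, j)"
    have coeff: "pauli_coeff \<sigma> j (mat_unit 2 i k) = \<sigma> j $$ (k, i) / 2" if "j < 4" for j
      using \<open>i < 2\<close> \<open>k < 2\<close> unfolding pauli_coeff_def mat_trace_mult[OF C[OF that] mat_unit_carrier]
      by (auto simp: mat_unit_def sum_lessThan_2 less_2_cases_iff)
    have "(\<Sum>p\<in>?K. M p $$ (k, i) * R p $$ (a, b)) =
        (\<Sum>j<4. \<Sum>s\<in>{1, - 1}. M (j, s) $$ (k, i) * R (j, s) $$ (a, b))"
      unfolding sum.cartesian_product by (intro sum.cong) auto
    also have "\<dots> = (\<Sum>j<4. 2 * complex_of_real (c j) * (?I k i * ?I a b + \<sigma> j $$ (k, i) * \<sigma> j $$ (a, b)))"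
      using that carrier_matD[OF C]
      by (intro sum.cong refl) (simp add: M_def R_def algebra_simps)
    also have "\<dots> = (\<Sum>j<4. complex_of_real (L j) * pauli_coeff \<sigma> j (mat_unit 2 i k) * \<sigma> j $$ (a, b))"
      by (simp add: sum_lessThan_4 coeff L0 \<sigma>0 c_def field_simps)
    also have "\<dots> = F (mat_unit 2 i k) $$ (a, b)"
      using that by (intro pauli_map_entry[OF F(1), symmetric]) auto
    finally show ?thesis ..
  qed
  have "map_tensor 2 m F id \<rho> \<in> sep_cone 2 m"
    using \<rho> by (intro measure_and_prepare_sep_cone[OF lin _ M R FMR]) (auto simp: is_state_def)
  moreover have "mat_trace (map_tensor 2 m F id \<rho>) = 1"
    using \<rho> map_tensor_trace[OF lin F(2) linear_on_mats_id, of m \<rho>]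
    by (simp add: is_state_def trace_preserving_def pos_semidef_carrier)
  ultimately show "separable 2 m (map_tensor 2 m F id \<rho>)"
    by (rule sep_cone_separable)
qed

section \<open>Schmidt decomposition\<close>

definition orthonormal_frame :: "(nat \<Rightarrow> nat \<Rightarrow> complex) \<Rightarrow> bool" where
  "orthonormal_frame e \<longleftrightarrow>
     (\<forall>i<2. \<forall>j<2. (\<Sum>a<2. e i a * cnj (e j a)) = (if i = j then 1 else 0)) \<and>
     (\<forall>a<2. \<forall>b<2. (\<Sum>i<2. e i a * cnj (e i b)) = (if a = b then 1 else 0))"

text \<open>A unit vector (g, h) is completed by a multiple \<open>u\<close>, of modulus 1, of the
  orthogonal vector (- cnj h, cnj g).\<close>

lemma orthonormal_frameI:
  assumes gh: "g * cnj g + h * cnj h = 1" and u: "u * cnj u = 1"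
    and e: "e 0 0 = g" "e 0 (Suc 0) = h" "e (Suc 0) 0 = - u * cnj h" "e (Suc 0) (Suc 0) = u * cnj g"
  shows "orthonormal_frame e"
proof -
  have uh: "h * (u * (cnj h * cnj u)) = h * cnj h" "g * (u * (cnj g * cnj u)) = g * cnj g"
    using u by (metis mult.assoc mult.commute mult.left_neutral)+
  have "h * cnj h + g * cnj g = 1" using gh by (simp add: add.commute)
  with gh u show ?thesis
    unfolding orthonormal_frame_def
    by (auto simp: less_2_cases_iff sum_lessThan_2 e uh mult_ac)
qed

lemma orthonormal_frame_swap:
  assumes "orthonormal_frame e"
  shows "orthonormal_frame (\<lambda>i. e (1 - i))"
  using assms unfolding orthonormal_frame_def
  by (auto simp: less_2_cases_iff sum_lessThan_2 add.commute)

lemma normalise_pair: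
  fixes g h :: complex
  assumes "g \<noteq> 0 \<or> h \<noteq> 0"
  obtains n where "0 < n" "(g / complex_of_real n) * cnj (g / complex_of_real n) +
    (h / complex_of_real n) * cnj (h / complex_of_real n) = 1"
proof -
  define n where "n = sqrt ((cmod g)\<^sup>2 + (cmod h)\<^sup>2)"
  have pos: "0 < (cmod g)\<^sup>2 + (cmod h)\<^sup>2"
    using assms by (auto simp: add_pos_nonneg add_nonneg_pos)
  then have n: "0 < n" and n2: "n * n = (cmod g)\<^sup>2 + (cmod h)\<^sup>2"
    by (simp_all add: n_def)
  have "g * cnj g + h * cnj h = complex_of_real (n * n)"
    unfolding n2 of_real_add complex_norm_square ..
  then have "(g / complex_of_real n) * cnj (g / complex_of_real n) +
    (h / complex_of_real n) * cnj (h / complex_of_real n) = complex_of_real (n * n) / complex_of_real (n * n)"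
    by (simp add: add_divide_distrib[symmetric])
  with n show thesis by (intro that[of n]) auto
qed

lemma complex_quadratic_root:
  fixes a b c :: complex
  assumes "a \<noteq> 0"
  shows "\<exists>z. a * z\<^sup>2 + b * z + c = 0"
proof -
  define r where "r = csqrt (b\<^sup>2 - 4 * a * c)"
  have "r * r = b\<^sup>2 - 4 * a * c"
    unfolding r_def power2_eq_square[symmetric] by (rule power2_csqrt)
  moreover have "4 * a * (a * ((r - b) / (2 * a))\<^sup>2 + b * ((r - b) / (2 * a)) + c) = r * r - b\<^sup>2 + 4 * a * c"
    using assms by (simp add: power2_eq_square field_simps)
  ultimately have "4 * a * (a * ((r - b) / (2 * a))\<^sup>2 + b * ((r - b) / (2 * a)) + c) = 0"
    by simp
  then show ?thesis using assms by (metis mult_eq_0_iff zero_neq_numeral)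
qed

text \<open>Normalising \<open>x\<close> gives the first vector. Being orthogonal to
  \<open>x\<close>, \<open>y\<close> is a multiple of the complementary vector; the phase of the
  multiple goes into the frame and its modulus is \<open>s\<close>.\<close>

lemma orthogonal_pair_frame:
  fixes x y :: "nat \<Rightarrow> complex"
  assumes orth: "(\<Sum>b<2. cnj (x b) * y b) = 0" and x: "x 0 \<noteq> 0 \<or> x 1 \<noteq> 0"
  shows "\<exists>c s f. 0 \<le> c \<and> 0 \<le> s \<and> orthonormal_frame f \<and>
    (\<forall>b<2. x b = complex_of_real c * f 0 b \<and> y b = complex_of_real s * f 1 b)"
proof -
  obtain n where n: "0 < n" and norm: "(x 0 / complex_of_real n) * cnj (x 0 / complex_of_real n) +
    (x 1 / complex_of_real n) * cnj (x 1 / complex_of_real n) = 1"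
    using normalise_pair[OF x] by blast
  define g h where "g = x 0 / complex_of_real n" and "h = x 1 / complex_of_real n"
  have gh: "g * cnj g + h * cnj h = 1" using norm by (simp only: g_def h_def)
  have x_eq: "x 0 = complex_of_real n * g" "x 1 = complex_of_real n * h"
    using n by (simp_all add: g_def h_def)
  have "complex_of_real n * (cnj g * y 0 + cnj h * y 1) = 0"
    using orth x_eq by (simp add: sum_lessThan_2 algebra_simps)
  then have o: "cnj g * y 0 + cnj h * y 1 = 0" using n by simp
  \<comment> \<open>The coefficient of \<open>y\<close> along (- cnj h, cnj g).\<close>
  define \<eta> where "\<eta> = g * y 1 - h * y 0"
  have o': "cnj h * y 1 = - (cnj g * y 0)"
    using o by (simp add: eq_neg_iff_add_eq_0 add.commute)
  have o'': "cnj g * y 0 = - (cnj h * y 1)"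
    using o by (simp add: eq_neg_iff_add_eq_0)
  have "- \<eta> * cnj h = (h * cnj h) * y 0 - g * (cnj h * y 1)"
    by (simp add: \<eta>_def algebra_simps)
  also have "\<dots> = (g * cnj g + h * cnj h) * y 0"
    unfolding o' by (simp add: algebra_simps)
  finally have y0: "y 0 = - \<eta> * cnj h" unfolding gh by simp
  have "\<eta> * cnj g = (g * cnj g) * y 1 - h * (cnj g * y 0)"
    by (simp add: \<eta>_def algebra_simps)
  also have "\<dots> = (g * cnj g + h * cnj h) * y 1"
    unfolding o'' by (simp add: algebra_simps)
  finally have y1: "y 1 = \<eta> * cnj g" unfolding gh by simp
  define u where "u = (if \<eta> = 0 then 1 else \<eta> / complex_of_real (cmod \<eta>))"
  have u: "u * cnj u = 1"
    using complex_norm_square[of \<eta>] by (simp add: u_def power2_eq_square)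
  have \<eta>: "\<eta> = complex_of_real (cmod \<eta>) * u" by (simp add: u_def)
  define f where "f i b = (if i = 0 then if b = 0 then g else h
    else if b = 0 then - u * cnj h else u * cnj g)" for i b :: nat
  have "orthonormal_frame f"
    by (rule orthonormal_frameI[OF gh u]) (simp_all add: f_def)
  moreover have "x b = complex_of_real n * f 0 b \<and> y b = complex_of_real (cmod \<eta>) * f 1 b" if "b < 2" for b
  proof -
    have "b = 0 \<or> b = 1" using that by auto
    moreover have "y 0 = complex_of_real (cmod \<eta>) * f 1 0" "y 1 = complex_of_real (cmod \<eta>) * f 1 1"
      using y0 y1 \<eta> by (simp_all add: f_def)
    ultimately show ?thesis using x_eq by (auto simp: f_def)
  qed
  ultimately show ?thesis
    using n by (intro exI[of _ n] exI[of _ "cmod \<eta>"] exI[of _ f]) simp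
qed

text \<open>If \<open>x = 0\<close>, the roles of \<open>x\<close> and \<open>y\<close> are
  exchanged and the frame is swapped back; if both vanish, any frame serves.\<close>

lemma orthogonal_pair_frame':
  fixes x y :: "nat \<Rightarrow> complex"
  assumes orth: "(\<Sum>b<2. cnj (x b) * y b) = 0"
  shows "\<exists>c s f. 0 \<le> c \<and> 0 \<le> s \<and> orthonormal_frame f \<and>
    (\<forall>b<2. x b = complex_of_real c * f 0 b \<and> y b = complex_of_real s * f 1 b)"
proof (cases "x 0 \<noteq> 0 \<or> x 1 \<noteq> 0")
  case True
  then show ?thesis using orthogonal_pair_frame[OF orth] by blast
next
  case x: False
  show ?thesis
  proof (cases "y 0 \<noteq> 0 \<or> y 1 \<noteq> 0")
    case True
    have "(\<Sum>b<2. cnj (y b) * x b) = 0" using x by (simp add: sum_lessThan_2)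
    from orthogonal_pair_frame[OF this True] obtain c s f where f: "0 \<le> c" "0 \<le> s" "orthonormal_frame f"
      "\<forall>b<2. y b = complex_of_real c * f 0 b \<and> x b = complex_of_real s * f 1 b"
      by blast
    then show ?thesis
      using orthonormal_frame_swap[OF f(3)]
      by (intro exI[of _ s] exI[of _ c] exI[of _ "\<lambda>i. f (1 - i)"]) simp
  next
    case False
    have "orthonormal_frame (\<lambda>i b. if i = b then 1 else 0)"
      by (rule orthonormal_frameI[of 1 0 1]) simp_all
    moreover have "x b = 0 \<and> y b = 0" if "b < 2" for b
      using x False that by (auto simp: less_2_cases_iff)
    ultimately show ?thesis
      by (intro exI[of _ 0] exI[of _ "\<lambda>i b. if i = b then 1 else 0"]) simp
  qed
qed

text \<open>Orthogonality of the two coefficient vectors \<open>x\<close> and \<open>y\<close> of \<open>M\<close> along the frame spanned by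
  \<open>(g, h)\<close> is a homogeneous quadratic equation in \<open>(g, h)\<close>, so no eigenvalues are needed.\<close>

lemma schmidt_decomposition:
  fixes M :: "nat \<Rightarrow> nat \<Rightarrow> complex"
  obtains c s e f where "0 \<le> c" "0 \<le> s" "orthonormal_frame e" "orthonormal_frame f"
    "\<And>a b. a < 2 \<Longrightarrow> b < 2 \<Longrightarrow>
      M a b = complex_of_real c * e 0 a * f 0 b + complex_of_real s * e 1 a * f 1 b"
proof -
  define A B C D where "A = (\<Sum>b<2. cnj (M 0 b) * M 0 b)" and "B = (\<Sum>b<2. cnj (M 0 b) * M 1 b)"
    and "C = (\<Sum>b<2. cnj (M 1 b) * M 0 b)" and "D = (\<Sum>b<2. cnj (M 1 b) * M 1 b)"
  \<comment> \<open>If the leading coefficient vanishes, (1, 0) is a solution; otherwise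
    \<open>h0 = 1\<close> leaves an ordinary quadratic equation for \<open>g0\<close>.\<close>
  obtain g0 h0 where gh0: "g0 \<noteq> 0 \<or> h0 \<noteq> 0" and quad0: "B * g0\<^sup>2 + (D - A) * g0 * h0 - C * h0\<^sup>2 = 0"
  proof (cases "B = 0")
    case True
    then show thesis by (intro that[of 1 0]) auto
  next
    case False
    then obtain z where "B * z\<^sup>2 + (D - A) * z + - C = 0"
      using complex_quadratic_root by blast
    then show thesis by (intro that[of z 1]) auto
  qed
  obtain n where n: "0 < n" and norm: "(g0 / complex_of_real n) * cnj (g0 / complex_of_real n) +
    (h0 / complex_of_real n) * cnj (h0 / complex_of_real n) = 1"
    using normalise_pair[OF gh0] by blast
  define g h where "g = g0 / complex_of_real n" and "h = h0 / complex_of_real n"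
  have gh: "g * cnj g + h * cnj h = 1" using norm by (simp only: g_def h_def)
  have "B * g\<^sup>2 + (D - A) * g * h - C * h\<^sup>2 = (B * g0\<^sup>2 + (D - A) * g0 * h0 - C * h0\<^sup>2) / (complex_of_real n)\<^sup>2"
    by (simp add: g_def h_def power2_eq_square add_divide_distrib diff_divide_distrib)
  then have quad: "B * g\<^sup>2 + (D - A) * g * h - C * h\<^sup>2 = 0" using quad0 by simp
  define e where "e i b = (if i = 0 then if b = 0 then g else h
    else if b = 0 then - cnj h else cnj g)" for i b :: nat
  have e: "orthonormal_frame e"
    by (rule orthonormal_frameI[OF gh, of 1]) (simp_all add: e_def)
  define x y where "x b = (\<Sum>a<2. cnj (e 0 a) * M a b)" and "y b = (\<Sum>a<2. cnj (e 1 a) * M a b)" for b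
  \<comment> \<open>Since \<open>e 1\<close> consists of conjugates of \<open>g\<close> and
    \<open>h\<close>, neither \<open>cnj (x b)\<close> nor \<open>y b\<close> contains a conjugate
    of them; the inner product is therefore a polynomial in \<open>g\<close> and
    \<open>h\<close>.\<close>
  have "(\<Sum>b<2. cnj (x b) * y b) = B * g\<^sup>2 + (D - A) * g * h - C * h\<^sup>2"
    by (simp add: x_def y_def e_def A_def B_def C_def D_def sum_lessThan_2 power2_eq_square algebra_simps)
  then obtain c s f where f: "0 \<le> c" "0 \<le> s" "orthonormal_frame f"
    and xy: "\<forall>b<2. x b = complex_of_real c * f 0 b \<and> y b = complex_of_real s * f 1 b"
    using orthogonal_pair_frame'[of x y] quad by auto
  have "M a b = complex_of_real c * e 0 a * f 0 b + complex_of_real s * e 1 a * f 1 b"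
    if "a < 2" "b < 2" for a b
  proof -
    have "a = 0 \<or> a = 1" using that by auto
    then have "e 0 a * x b + e 1 a * y b = (g * cnj g + h * cnj h) * M a b"
      by (elim disjE) (simp_all add: x_def y_def e_def sum_lessThan_2 algebra_simps)
    then have "M a b = e 0 a * x b + e 1 a * y b" unfolding gh by simp
    then show ?thesis using xy that by (simp add: mult_ac)
  qed
  with f e show thesis by (intro that) auto
qed

text \<open>Cauchy--Schwarz is used twice, each time through the Lagrange identity: first for
  \<open>d\<close>, then for the plane vectors (S, r) and (d, -(x + y)). The bounds meet because
  \<open>(x + y)^2 + (1 - x^2) (1 - y^2) = (1 + x y)^2\<close>.\<close>

lemma schmidt_weights_nonneg:
  fixes c s p1 p2 q1 q2 x y :: real
  assumes p: "p1\<^sup>2 + p2\<^sup>2 + x\<^sup>2 \<le> 1" and q: "q1\<^sup>2 + q2\<^sup>2 + y\<^sup>2 \<le> 1"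
  shows "0 \<le> (c\<^sup>2 + s\<^sup>2) * (1 + x * y) + (c\<^sup>2 - s\<^sup>2) * (x + y) - 2 * c * s * (p1 * q1 + p2 * q2)"
proof -
  define d where "d = p1 * q1 + p2 * q2"
  have "d\<^sup>2 + (p1 * q2 - p2 * q1)\<^sup>2 = (p1\<^sup>2 + p2\<^sup>2) * (q1\<^sup>2 + q2\<^sup>2)"
    by (simp add: d_def power2_eq_square algebra_simps)
  then have "d\<^sup>2 \<le> (p1\<^sup>2 + p2\<^sup>2) * (q1\<^sup>2 + q2\<^sup>2)"
    using zero_le_power2[of "p1 * q2 - p2 * q1"] by linarith
  also have "\<dots> \<le> (1 - x\<^sup>2) * (1 - y\<^sup>2)"
    using p q zero_le_power2[of p1] zero_le_power2[of p2] zero_le_power2[of q1] zero_le_power2[of q2]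
    by (intro mult_mono) linarith+
  finally have d: "d\<^sup>2 \<le> (1 - x\<^sup>2) * (1 - y\<^sup>2)" .
  have "\<bar>x\<bar> \<le> 1" "\<bar>y\<bar> \<le> 1"
    using p q zero_le_power2[of p1] zero_le_power2[of p2] zero_le_power2[of q1] zero_le_power2[of q2]
    unfolding abs_square_le_1[symmetric] by linarith+
  then have "\<bar>x * y\<bar> \<le> 1" by (simp add: abs_mult mult_le_one)
  then have xy: "0 \<le> 1 + x * y" by linarith
  let ?r = "c\<^sup>2 - s\<^sup>2" and ?S = "2 * c * s" and ?t = "c\<^sup>2 + s\<^sup>2"
  have t: "?r\<^sup>2 + ?S\<^sup>2 = ?t\<^sup>2" by (simp add: power2_eq_square algebra_simps)
  have "(?S * d - ?r * (x + y))\<^sup>2 + (?S * (x + y) + ?r * d)\<^sup>2 = (?r\<^sup>2 + ?S\<^sup>2) * ((x + y)\<^sup>2 + d\<^sup>2)"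
    by (simp add: power2_eq_square algebra_simps)
  then have "(?S * d - ?r * (x + y))\<^sup>2 \<le> ?t\<^sup>2 * ((x + y)\<^sup>2 + d\<^sup>2)"
    unfolding t using zero_le_power2[of "?S * (x + y) + ?r * d"] by linarith
  also have "\<dots> \<le> ?t\<^sup>2 * ((x + y)\<^sup>2 + (1 - x\<^sup>2) * (1 - y\<^sup>2))"
    using d by (intro mult_left_mono) auto
  also have "\<dots> = (?t * (1 + x * y))\<^sup>2"
    by (simp add: power2_eq_square algebra_simps)
  finally have "?S * d - ?r * (x + y) \<le> ?t * (1 + x * y)"
    by (rule power2_le_imp_le) (use xy in simp)
  then show ?thesis by (simp add: d_def)
qed

section \<open>Pauli matrices of a frame\<close>

definition dyad :: "(nat \<Rightarrow> complex) \<Rightarrow> (nat \<Rightarrow> complex) \<Rightarrow> complex mat" where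
  "dyad u v = mat 2 2 (\<lambda>(a, b). u a * cnj (v b))"

definition pauli_entry :: "nat \<Rightarrow> nat \<Rightarrow> nat \<Rightarrow> complex" where
  "pauli_entry j i l =
    (if j = 0 then if i = l then 1 else 0
     else if j = 1 then if i = l then 0 else 1
     else if j = 2 then if i = l then 0 else if i = 0 then - \<i> else \<i>
     else if i = l then if i = 0 then 1 else - 1 else 0)"

text \<open>The standard Pauli matrices conjugated by the unitary that takes the standard basis to
  \<open>e\<close>.\<close>

definition frame_pauli :: "(nat \<Rightarrow> nat \<Rightarrow> complex) \<Rightarrow> nat \<Rightarrow> complex mat" where
  "frame_pauli e j = mat 2 2 (\<lambda>(a, b). \<Sum>i<2. \<Sum>l<2. pauli_entry j i l * (e i a * cnj (e l b)))"

lemma frame_pauli_carrier [simp]: "frame_pauli e j \<in> carrier_mat 2 2"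
  by (simp add: frame_pauli_def)

text \<open>Orthonormality reduces the traces to those of the standard matrices, which form a finite
  table.\<close>

lemma frame_pauli_trace:
  assumes e: "orthonormal_frame e"
  shows "mat_trace (frame_pauli e j * frame_pauli e k) = (\<Sum>i<2. \<Sum>l<2. pauli_entry j i l * pauli_entry k l i)"
proof -
  have gram: "(\<Sum>a<2. \<Sum>b<2. (e i a * cnj (e l b)) * (e m b * cnj (e n a))) =
      (if i = n \<and> m = l then 1 else 0)" if "i < 2" "l < 2" "m < 2" "n < 2" for i l m n
  proof -
    have "(\<Sum>a<2. \<Sum>b<2. (e i a * cnj (e l b)) * (e m b * cnj (e n a))) =
        (\<Sum>a<2. e i a * cnj (e n a)) * (\<Sum>b<2. e m b * cnj (e l b))"
      by (simp add: sum_lessThan_2 algebra_simps)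
    then show ?thesis using e that by (simp add: orthonormal_frame_def)
  qed
  let ?D = "\<lambda>i l a b. e i a * cnj (e l b)"
  have expand: "(\<Sum>a<2. \<Sum>b<2. (\<Sum>i<2. \<Sum>l<2. t i l * D i l a b) * (\<Sum>m<2. \<Sum>n<2. u m n * D m n b a)) =
      (\<Sum>i<2. \<Sum>l<2. \<Sum>m<2. \<Sum>n<2. t i l * u m n * (\<Sum>a<2. \<Sum>b<2. D i l a b * D m n b a))"
    for t u :: "nat \<Rightarrow> nat \<Rightarrow> complex" and D :: "nat \<Rightarrow> nat \<Rightarrow> nat \<Rightarrow> nat \<Rightarrow> complex"
    by (simp add: sum_lessThan_2 algebra_simps)
  have "mat_trace (frame_pauli e j * frame_pauli e k) =
      (\<Sum>a<2. \<Sum>b<2. (\<Sum>i<2. \<Sum>l<2. pauli_entry j i l * ?D i l a b) *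
        (\<Sum>m<2. \<Sum>n<2. pauli_entry k m n * ?D m n b a))"
    unfolding mat_trace_mult[OF frame_pauli_carrier frame_pauli_carrier]
    by (intro sum.cong refl) (simp add: frame_pauli_def)
  also have "\<dots> = (\<Sum>i<2. \<Sum>l<2. \<Sum>m<2. \<Sum>n<2. pauli_entry j i l * pauli_entry k m n *
      (if i = n \<and> m = l then 1 else 0))"
    unfolding expand[of "pauli_entry j" ?D "pauli_entry k"]
    by (intro sum.cong refl) (simp add: gram)
  also have "\<dots> = (\<Sum>i<2. \<Sum>l<2. pauli_entry j i l * pauli_entry k l i)"
    by (simp add: sum_lessThan_2)
  finally show ?thesis .
qed

lemma frame_pauli_basis:
  assumes e: "orthonormal_frame e"
  shows "pauli_basis (frame_pauli e)"
  unfolding pauli_basis_def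
proof (intro conjI allI impI)
  have compl: "(\<Sum>i<2. e i a * cnj (e i b)) = (if a = b then 1 else 0)" if "a < 2" "b < 2" for a b
    using e that by (simp add: orthonormal_frame_def)
  show "frame_pauli e 0 = 1\<^sub>m 2"
  proof (rule eq_matI)
    fix a b assume "a < dim_row (1\<^sub>m 2 :: complex mat)" "b < dim_col (1\<^sub>m 2 :: complex mat)"
    then have ab: "a < 2" "b < 2" by simp_all
    then have "frame_pauli e 0 $$ (a, b) = (\<Sum>i<2. e i a * cnj (e i b))"
      by (simp add: frame_pauli_def pauli_entry_def sum_lessThan_2)
    then show "frame_pauli e 0 $$ (a, b) = 1\<^sub>m 2 $$ (a, b)"
      using ab compl[OF ab] by simp
  qed (simp_all add: frame_pauli_def)
next
  fix j :: nat assume "j < 4"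
  then have "j \<in> {0, 1, 2, 3}" by auto
  then have "cnj (pauli_entry j l i) = pauli_entry j i l" if "i < 2" "l < 2" for i l
    using that by (auto simp: pauli_entry_def less_2_cases_iff)
  then show "self_adjoint 2 (frame_pauli e j)"
    by (simp add: self_adjoint_iff frame_pauli_def sum_lessThan_2 algebra_simps)
next
  fix j k :: nat assume "j < 4" "k < 4"
  then have "j \<in> {0, 1, 2, 3}" "k \<in> {0, 1, 2, 3}" by auto
  then show "mat_trace (frame_pauli e j * frame_pauli e k) = (if j = k then 2 else 0)"
    unfolding frame_pauli_trace[OF e]
    by (elim insertE emptyE) (simp_all add: sum_lessThan_2 pauli_entry_def)
qed

section \<open>Pauli coefficients of images under a diagonal map\<close>

lemma mat_trace_self_adjoint_mult:
  assumes A: "self_adjoint n A" and B: "self_adjoint n B"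
  shows "mat_trace (A * B) = complex_of_real (Re (mat_trace (A * B)))"
proof -
  have C: "A \<in> carrier_mat n n" "B \<in> carrier_mat n n"
    using A B by (auto simp: self_adjoint_def)
  have h: "A $$ (b, a) = cnj (A $$ (a, b))" "B $$ (b, a) = cnj (B $$ (a, b))" if "a < n" "b < n" for a b
    using A B that unfolding self_adjoint_iff by (blast, blast)
  have "cnj (mat_trace (A * B)) = (\<Sum>a<n. \<Sum>b<n. A $$ (b, a) * B $$ (a, b))"
    unfolding mat_trace_mult[OF C] cnj_sum
  proof (intro sum.cong refl)
    fix a b assume "a \<in> {..<n}" "b \<in> {..<n}"
    then have "a < n" "b < n" by simp_all
    then show "cnj (A $$ (a, b) * B $$ (b, a)) = A $$ (b, a) * B $$ (a, b)"
      using h(1)[of a b] h(2)[of b a] by simp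
  qed
  also have "\<dots> = (\<Sum>b<n. \<Sum>a<n. A $$ (b, a) * B $$ (a, b))"
    by (rule sum.swap)
  also have "\<dots> = mat_trace (A * B)" unfolding mat_trace_mult[OF C] ..
  finally show ?thesis by (metis Reals_cnj_iff of_real_Re)
qed

lemma pauli_parseval:
  assumes \<sigma>: "pauli_basis \<sigma>" and Y: "Y \<in> carrier_mat 2 2" and Z: "Z \<in> carrier_mat 2 2"
  shows "mat_trace (Y * Z) = 2 * (\<Sum>j<4. pauli_coeff \<sigma> j Y * pauli_coeff \<sigma> j Z)"
proof -
  have "mat_trace (Y * Z) = (\<Sum>a<2. \<Sum>b<2. (\<Sum>j<4. pauli_coeff \<sigma> j Y * \<sigma> j $$ (a, b)) * Z $$ (b, a))"
    unfolding mat_trace_mult[OF Y Z]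
    by (intro sum.cong refl) (simp add: pauli_expansion[OF \<sigma> Y])
  also have "\<dots> = (\<Sum>j<4. pauli_coeff \<sigma> j Y * (\<Sum>a<2. \<Sum>b<2. \<sigma> j $$ (a, b) * Z $$ (b, a)))"
    by (simp add: sum_lessThan_2 sum_lessThan_4 algebra_simps)
  also have "\<dots> = (\<Sum>j<4. pauli_coeff \<sigma> j Y * (2 * pauli_coeff \<sigma> j Z))"
    using mat_trace_mult[OF pauli_basis_carrier[OF \<sigma>] Z]
    by (intro sum.cong refl) (simp add: pauli_coeff_def)
  finally show ?thesis by (simp add: sum_distrib_left mult_ac)
qed

lemma pauli_coeff_map:
  assumes F: "pauli_map F \<sigma> L" and X: "X \<in> carrier_mat 2 2" and k: "k < 4"
  shows "pauli_coeff \<sigma> k (F X) = complex_of_real (L k) * pauli_coeff \<sigma> k X"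
proof -
  have \<sigma>: "pauli_basis \<sigma>" and lin: "linear_on_mats 2 F"
    using F by (auto simp: pauli_map_def)
  note C = pauli_basis_carrier[OF \<sigma>]
  have "mat_trace (\<sigma> k * F X) =
      (\<Sum>a<2. \<Sum>b<2. \<sigma> k $$ (a, b) * (\<Sum>j<4. complex_of_real (L j) * pauli_coeff \<sigma> j X * \<sigma> j $$ (b, a)))"
    unfolding mat_trace_mult[OF C[OF k] linear_on_mats_carrier[OF lin X]]
    by (intro sum.cong refl) (simp add: pauli_map_entry[OF F X])
  also have "\<dots> = (\<Sum>j<4. complex_of_real (L j) * pauli_coeff \<sigma> j X * (\<Sum>a<2. \<Sum>b<2. \<sigma> k $$ (a, b) * \<sigma> j $$ (b, a)))"
    by (simp add: sum_lessThan_2 sum_lessThan_4 algebra_simps)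
  also have "\<dots> = (\<Sum>j<4. complex_of_real (L j) * pauli_coeff \<sigma> j X * (if j = k then 2 else 0))"
  proof (intro sum.cong refl)
    fix j :: nat assume "j \<in> {..<4}"
    then have j: "j < 4" by simp
    have "(\<Sum>a<2. \<Sum>b<2. \<sigma> k $$ (a, b) * \<sigma> j $$ (b, a)) = mat_trace (\<sigma> k * \<sigma> j)"
      by (rule mat_trace_mult[OF C[OF k] C[OF j], symmetric])
    also have "\<dots> = (if j = k then 2 else 0)"
      using \<sigma> j k by (simp add: pauli_basis_def)
    finally show "complex_of_real (L j) * pauli_coeff \<sigma> j X * (\<Sum>a<2. \<Sum>b<2. \<sigma> k $$ (a, b) * \<sigma> j $$ (b, a)) =
        complex_of_real (L j) * pauli_coeff \<sigma> j X * (if j = k then 2 else 0)"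
      by simp
  qed
  also have "\<dots> = complex_of_real (L k) * pauli_coeff \<sigma> k X * 2"
    using k by (simp add: if_distrib[of "\<lambda>z. _ * z"] cong: if_cong)
  finally show ?thesis by (simp add: pauli_coeff_def)
qed

text \<open>The map scales the Bloch vector of \<open>X\<close> componentwise by \<open>L\<close>,
  and \<open>sqrt q\<close> is the length of the result. Dividing by it leaves a Bloch vector of
  length at most 1, which makes 1 + A and 1 - A positive.\<close>

lemma pauli_map_image_bounded:
  assumes F: "pauli_map F \<sigma> L" and X: "self_adjoint 2 X" "mat_trace X = 0"
  defines "q \<equiv> (\<Sum>j\<in>{1, 2, 3}. (L j * Re (pauli_coeff \<sigma> j X))\<^sup>2)"
  shows "\<exists>A. A \<in> carrier_mat 2 2 \<and> F X = complex_of_real (sqrt q) \<cdot>\<^sub>m A \<and>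
    (\<forall>s. s\<^sup>2 = 1 \<longrightarrow> pos_semidef 2 (1\<^sub>m 2 + complex_of_real s \<cdot>\<^sub>m A))"
proof -
  have \<sigma>: "pauli_basis \<sigma>" and lin: "linear_on_mats 2 F"
    using F by (auto simp: pauli_map_def)
  have XC: "X \<in> carrier_mat 2 2" using X by (simp add: self_adjoint_def)
  note FC = linear_on_mats_carrier[OF lin XC]
  define t where "t j = Re (pauli_coeff \<sigma> j X)" for j
  have t: "pauli_coeff \<sigma> j X = complex_of_real (t j)" if "j < 4" for j
  proof -
    have "self_adjoint 2 (\<sigma> j)" using \<sigma> that by (simp add: pauli_basis_def)
    from mat_trace_self_adjoint_mult[OF this X(1)] show ?thesis
      unfolding t_def pauli_coeff_def by (metis Re_divide_numeral of_real_divide of_real_numeral)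
  qed
  have "pauli_coeff \<sigma> 0 X = 0"
    using \<sigma> X XC by (simp add: pauli_coeff_def pauli_basis_def)
  then have t0: "t 0 = 0" by (simp add: t_def)
  have entry: "F X $$ (a, b) = (\<Sum>j<4. complex_of_real (L j * t j) * \<sigma> j $$ (a, b))" if "a < 2" "b < 2" for a b
    unfolding pauli_map_entry[OF F XC that] by (intro sum.cong refl) (simp add: t)
  have "mat_trace (F X * F X) = 2 * (\<Sum>j<4. complex_of_real (L j * t j) * complex_of_real (L j * t j))"
    unfolding pauli_parseval[OF \<sigma> FC FC]
    by (intro arg_cong[where f = "\<lambda>z. 2 * z"] sum.cong refl) (simp add: pauli_coeff_map[OF F XC] t)
  also have "\<dots> = complex_of_real (2 * q)"
    by (simp add: q_def t_def[symmetric] t0 sum_lessThan_4 power2_eq_square)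
  finally have tr2: "mat_trace (F X * F X) = complex_of_real (2 * q)" .
  have "pauli_coeff \<sigma> 0 (F X) = 0"
    using pauli_coeff_map[OF F XC, of 0] t[of 0] t0 by simp
  then have tr: "mat_trace (F X) = 0"
    using \<sigma> FC by (simp add: pauli_coeff_def pauli_basis_def)
  have sa: "self_adjoint 2 (F X)"
    unfolding self_adjoint_iff
  proof (intro conjI allI impI FC)
    fix a b :: nat assume ab: "a < 2" "b < 2"
    have herm: "\<sigma> j $$ (b, a) = cnj (\<sigma> j $$ (a, b))" if "j < 4" for j
    proof -
      have "self_adjoint 2 (\<sigma> j)" using \<sigma> that by (simp add: pauli_basis_def)
      then show ?thesis using ab unfolding self_adjoint_iff by blast
    qed
    show "F X $$ (b, a) = cnj (F X $$ (a, b))"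
      unfolding entry[OF ab] entry[OF ab(2,1)] cnj_sum
      by (intro sum.cong refl) (simp add: herm)
  qed
  have q: "0 \<le> q" unfolding q_def by (intro sum_nonneg) simp
  \<comment> \<open>For \<open>q = 0\<close> the factor is 0 by convention; then both
    \<open>F X\<close> and \<open>?A\<close> vanish.\<close>
  let ?A = "complex_of_real (1 / sqrt q) \<cdot>\<^sub>m F X"
  have "F X = complex_of_real (sqrt q) \<cdot>\<^sub>m ?A"
  proof (cases "q = 0")
    case True
    then have "(\<Sum>j\<in>{1, 2, 3}. (L j * t j)\<^sup>2) = 0" by (simp add: q_def t_def)
    then have "\<forall>j\<in>{1, 2, 3}. (L j * t j)\<^sup>2 = 0" by (subst (asm) sum_nonneg_eq_0_iff) auto
    then have "F X $$ (a, b) = 0" if "a < 2" "b < 2" for a b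
      unfolding entry[OF that] by (auto simp: sum_lessThan_4 t0)
    then show ?thesis using True FC by (intro eq_matI) auto
  next
    case False
    then show ?thesis using FC by (intro eq_matI) auto
  qed
  moreover have "pos_semidef 2 (1\<^sub>m 2 + complex_of_real s \<cdot>\<^sub>m ?A)" if "s\<^sup>2 = 1" for s
  proof -
    have "(s / sqrt q)\<^sup>2 * (2 * q) \<le> 2"
      using that q by (simp add: power_divide)
    then have "pos_semidef 2 (1\<^sub>m 2 + complex_of_real (s / sqrt q) \<cdot>\<^sub>m F X)"
      by (rule pos_semidef_one_plus[OF sa tr tr2])
    moreover have "complex_of_real (s / sqrt q) \<cdot>\<^sub>m F X = complex_of_real s \<cdot>\<^sub>m ?A"
      using FC by (intro eq_matI) auto
    ultimately show ?thesis by simp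
  qed
  ultimately show ?thesis using FC by (intro exI[of _ ?A]) simp
qed

text \<open>The overlaps \<open>t i j\<close> of two Pauli bases form an orthogonal matrix, so
  summing the squared lengths of the images over \<open>i\<close> restores the sum of the squares of
  \<open>L\<close>, whatever the frame.\<close>

lemma pauli_map_basis_image:
  assumes F: "pauli_map F \<sigma> L" and X: "pauli_basis X"
  shows "\<exists>p A. (\<forall>i\<in>{1, 2, 3}. 0 \<le> p i \<and> A i \<in> carrier_mat 2 2 \<and> F (X i) = complex_of_real (p i) \<cdot>\<^sub>m A i \<and>
      (\<forall>s. s\<^sup>2 = 1 \<longrightarrow> pos_semidef 2 (1\<^sub>m 2 + complex_of_real s \<cdot>\<^sub>m A i))) \<and>
    (\<Sum>i\<in>{1, 2, 3}. (p i)\<^sup>2) = (\<Sum>j\<in>{1, 2, 3}. (L j)\<^sup>2)"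
proof -
  have \<sigma>: "pauli_basis \<sigma>" using F by (simp add: pauli_map_def)
  note C = pauli_basis_carrier[OF \<sigma>] and D = pauli_basis_carrier[OF X]
  have sa: "self_adjoint 2 (\<sigma> j)" "self_adjoint 2 (X j)" if "j < 4" for j
    using \<sigma> X that by (simp_all add: pauli_basis_def)
  define t where "t i j = Re (pauli_coeff \<sigma> j (X i))" for i j
  define q where "q i = (\<Sum>j\<in>{1, 2, 3}. (L j * t i j)\<^sup>2)" for i
  have "\<forall>i\<in>{1, 2, 3}. \<exists>A. A \<in> carrier_mat 2 2 \<and> F (X i) = complex_of_real (sqrt (q i)) \<cdot>\<^sub>m A \<and>
    (\<forall>s. s\<^sup>2 = 1 \<longrightarrow> pos_semidef 2 (1\<^sub>m 2 + complex_of_real s \<cdot>\<^sub>m A))"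
  proof
    fix i :: nat assume "i \<in> {1, 2, 3}"
    then have i: "i < 4" "i \<noteq> 0" by auto
    show "\<exists>A. A \<in> carrier_mat 2 2 \<and> F (X i) = complex_of_real (sqrt (q i)) \<cdot>\<^sub>m A \<and>
        (\<forall>s. s\<^sup>2 = 1 \<longrightarrow> pos_semidef 2 (1\<^sub>m 2 + complex_of_real s \<cdot>\<^sub>m A))"
      unfolding q_def t_def
      by (rule pauli_map_image_bounded[OF F sa(2)[OF i(1)] pauli_basis_trace[OF X i]])
  qed
  then obtain A where A: "\<forall>i\<in>{1, 2, 3}. A i \<in> carrier_mat 2 2 \<and> F (X i) = complex_of_real (sqrt (q i)) \<cdot>\<^sub>m A i \<and>
    (\<forall>s. s\<^sup>2 = 1 \<longrightarrow> pos_semidef 2 (1\<^sub>m 2 + complex_of_real s \<cdot>\<^sub>m A i))"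
    by metis
  \<comment> \<open>Parseval for \<open>\<sigma> j\<close> in the basis \<open>X\<close>; the
    coefficient at \<open>X 0\<close> is absent because \<open>\<sigma> j\<close> is
    traceless.\<close>
  have t1: "(\<Sum>i\<in>{1, 2, 3}. (t i j)\<^sup>2) = 1" if "j \<in> {1, 2, 3}" for j
  proof -
    have j: "j < 4" "j \<noteq> 0" using that by auto
    have coeff: "pauli_coeff X i (\<sigma> j) = complex_of_real (t i j)" if i: "i < 4" for i
    proof -
      have "mat_trace (X i * \<sigma> j) = mat_trace (\<sigma> j * X i)"
        by (simp add: mat_trace_mult[OF C[OF j(1)] D[OF i]] mat_trace_mult[OF D[OF i] C[OF j(1)]]
            sum_lessThan_2 mult.commute)
      moreover have "mat_trace (\<sigma> j * X i) / 2 = complex_of_real (t i j)"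
        using mat_trace_self_adjoint_mult[OF sa(1)[OF j(1)] sa(2)[OF i]]
        unfolding t_def pauli_coeff_def by (metis Re_divide_numeral of_real_divide of_real_numeral)
      ultimately show ?thesis by (simp add: pauli_coeff_def)
    qed
    have "pauli_coeff X 0 (\<sigma> j) = 0"
      using X C[OF j(1)] pauli_basis_trace[OF \<sigma> j] by (simp add: pauli_coeff_def pauli_basis_def)
    then have "t 0 j = 0" using coeff[of 0] by simp
    have "complex_of_real 2 = mat_trace (\<sigma> j * \<sigma> j)"
      using \<sigma> j by (simp add: pauli_basis_def)
    also have "\<dots> = 2 * (\<Sum>i<4. complex_of_real (t i j) * complex_of_real (t i j))"
      unfolding pauli_parseval[OF X C[OF j(1)] C[OF j(1)]]
      by (intro arg_cong[where f = "\<lambda>z. 2 * z"] sum.cong refl) (simp add: coeff)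
    also have "\<dots> = complex_of_real (2 * (\<Sum>i\<in>{1, 2, 3}. (t i j)\<^sup>2))"
      using \<open>t 0 j = 0\<close> by (simp add: sum_lessThan_4 power2_eq_square)
    finally show ?thesis unfolding of_real_eq_iff by simp
  qed
  have q: "0 \<le> q i" for i unfolding q_def by (intro sum_nonneg) simp
  have "(\<Sum>i\<in>{1, 2, 3}. (sqrt (q i))\<^sup>2) = (\<Sum>i\<in>{1, 2, 3}. \<Sum>j\<in>{1, 2, 3}. (L j)\<^sup>2 * (t i j)\<^sup>2)"
    using q by (simp add: q_def power_mult_distrib)
  also have "\<dots> = (\<Sum>j\<in>{1, 2, 3}. (L j)\<^sup>2 * (\<Sum>i\<in>{1, 2, 3}. (t i j)\<^sup>2))"
    unfolding sum_distrib_left by (rule sum.swap)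
  also have "\<dots> = (\<Sum>j\<in>{1, 2, 3}. (L j)\<^sup>2)"
    by (intro sum.cong refl) (simp only: t1 mult_1_right)
  finally show ?thesis
    using A q by (intro exI[of _ "\<lambda>i. sqrt (q i)"] exI[of _ A]) simp
qed

section \<open>Images of pure states\<close>

text \<open>The factors 1 and - 1 are kept explicit to give all four identities one shape, so that a
  single linearity computation covers them.\<close>

lemma dyad_frame_pauli:
  "dyad (e 0) (e 0) = (1 / 2) \<cdot>\<^sub>m (frame_pauli e 0 + 1 \<cdot>\<^sub>m frame_pauli e 3)"
  "dyad (e 1) (e 1) = (1 / 2) \<cdot>\<^sub>m (frame_pauli e 0 + (- 1) \<cdot>\<^sub>m frame_pauli e 3)"
  "dyad (e 0) (e 1) = (1 / 2) \<cdot>\<^sub>m (frame_pauli e 1 + \<i> \<cdot>\<^sub>m frame_pauli e 2)"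
  "dyad (e 1) (e 0) = (1 / 2) \<cdot>\<^sub>m (frame_pauli e 1 + (- \<i>) \<cdot>\<^sub>m frame_pauli e 2)"
  by (intro eq_matI; simp add: dyad_def frame_pauli_def pauli_entry_def sum_lessThan_2 algebra_simps)+

lemma pauli_map_dyad_image:
  assumes F: "pauli_map F \<sigma> L" and e: "orthonormal_frame e"
    and A: "\<forall>i\<in>{1, 2, 3}. A i \<in> carrier_mat 2 2 \<and> F (frame_pauli e i) = complex_of_real (p i) \<cdot>\<^sub>m A i"
    and ab: "a < 2" "b < 2"
  shows "F (dyad (e 0) (e 0)) $$ (a, b) = (1\<^sub>m 2 $$ (a, b) + p 3 * A 3 $$ (a, b)) / 2"
    and "F (dyad (e 1) (e 1)) $$ (a, b) = (1\<^sub>m 2 $$ (a, b) - p 3 * A 3 $$ (a, b)) / 2"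
    and "F (dyad (e 0) (e 1)) $$ (a, b) = (p 1 * A 1 $$ (a, b) + \<i> * (p 2 * A 2 $$ (a, b))) / 2"
    and "F (dyad (e 1) (e 0)) $$ (a, b) = (p 1 * A 1 $$ (a, b) - \<i> * (p 2 * A 2 $$ (a, b))) / 2"
proof -
  have lin: "linear_on_mats 2 F" using F by (simp add: pauli_map_def)
  have F1: "F (frame_pauli e 0) = 1\<^sub>m 2"
  proof -
    have "\<forall>j<4. F (\<sigma> j) = complex_of_real (L j) \<cdot>\<^sub>m \<sigma> j" "L 0 = 1" "\<sigma> 0 = 1\<^sub>m 2"
      using F by (simp_all add: pauli_map_def pauli_basis_def)
    then have "F (1\<^sub>m 2) = 1 \<cdot>\<^sub>m 1\<^sub>m 2"
      by (metis of_real_1 zero_less_numeral)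
    moreover have "1 \<cdot>\<^sub>m 1\<^sub>m 2 = (1\<^sub>m 2 :: complex mat)" by auto
    moreover have "frame_pauli e 0 = 1\<^sub>m 2"
      using frame_pauli_basis[OF e] by (simp add: pauli_basis_def)
    ultimately show ?thesis by simp
  qed
  have comb: "F ((1 / 2) \<cdot>\<^sub>m (frame_pauli e j + z \<cdot>\<^sub>m frame_pauli e k)) $$ (a, b) =
      (F (frame_pauli e j) $$ (a, b) + z * F (frame_pauli e k) $$ (a, b)) / 2" for j k z
  proof -
    have "F ((1 / 2) \<cdot>\<^sub>m (frame_pauli e j + z \<cdot>\<^sub>m frame_pauli e k)) =
        (1 / 2) \<cdot>\<^sub>m (F (frame_pauli e j) + z \<cdot>\<^sub>m F (frame_pauli e k))"
      using lin by (simp add: linear_on_mats_def)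
    then show ?thesis
      using ab carrier_matD[OF linear_on_mats_carrier[OF lin frame_pauli_carrier]] by simp
  qed
  have FA: "F (frame_pauli e i) $$ (a, b) = p i * A i $$ (a, b)" if "i \<in> {1, 2, 3}" for i
  proof -
    have "A i \<in> carrier_mat 2 2" "F (frame_pauli e i) = complex_of_real (p i) \<cdot>\<^sub>m A i"
      using A that by auto
    then show ?thesis using ab by simp
  qed
  have FA': "F (frame_pauli e 1) $$ (a, b) = p 1 * A 1 $$ (a, b)"
    "F (frame_pauli e 2) $$ (a, b) = p 2 * A 2 $$ (a, b)"
    "F (frame_pauli e 3) $$ (a, b) = p 3 * A 3 $$ (a, b)"
    using FA by blast+
  show "F (dyad (e 0) (e 0)) $$ (a, b) = (1\<^sub>m 2 $$ (a, b) + p 3 * A 3 $$ (a, b)) / 2"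
    "F (dyad (e 1) (e 1)) $$ (a, b) = (1\<^sub>m 2 $$ (a, b) - p 3 * A 3 $$ (a, b)) / 2"
    "F (dyad (e 0) (e 1)) $$ (a, b) = (p 1 * A 1 $$ (a, b) + \<i> * (p 2 * A 2 $$ (a, b))) / 2"
    "F (dyad (e 1) (e 0)) $$ (a, b) = (p 1 * A 1 $$ (a, b) - \<i> * (p 2 * A 2 $$ (a, b))) / 2"
    unfolding dyad_frame_pauli comb F1 FA' by simp_all
qed

lemma pauli_map_pure_sep_cone:
  fixes v :: "nat \<Rightarrow> complex"
  assumes F: "pauli_map F \<sigma> L" and L: "(\<Sum>j\<in>{1, 2, 3}. (L j)\<^sup>2) \<le> 1"
  shows "map_tensor 2 2 F F (mat (2 * 2) (2 * 2) (\<lambda>(x, y). v x * cnj (v y))) \<in> sep_cone 2 2"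
proof -
  have lin: "linear_on_mats 2 F" using F by (simp add: pauli_map_def)
  obtain c s e f where cs: "0 \<le> c" "0 \<le> s" and e: "orthonormal_frame e" and f: "orthonormal_frame f"
    and schmidt: "\<And>a b. a < 2 \<Longrightarrow> b < 2 \<Longrightarrow>
      v (a * 2 + b) = complex_of_real c * e 0 a * f 0 b + complex_of_real s * e 1 a * f 1 b"
    using schmidt_decomposition[of "\<lambda>a b. v (a * 2 + b)"] by metis
  obtain p A where A: "\<forall>i\<in>{1, 2, 3}. 0 \<le> p i \<and> A i \<in> carrier_mat 2 2 \<and>
      F (frame_pauli e i) = complex_of_real (p i) \<cdot>\<^sub>m A i \<and>
      (\<forall>s. s\<^sup>2 = 1 \<longrightarrow> pos_semidef 2 (1\<^sub>m 2 + complex_of_real s \<cdot>\<^sub>m A i))"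
    and p: "(\<Sum>i\<in>{1, 2, 3}. (p i)\<^sup>2) = (\<Sum>j\<in>{1, 2, 3}. (L j)\<^sup>2)"
    using pauli_map_basis_image[OF F frame_pauli_basis[OF e]] by blast
  obtain q B where B: "\<forall>i\<in>{1, 2, 3}. 0 \<le> q i \<and> B i \<in> carrier_mat 2 2 \<and>
      F (frame_pauli f i) = complex_of_real (q i) \<cdot>\<^sub>m B i \<and>
      (\<forall>s. s\<^sup>2 = 1 \<longrightarrow> pos_semidef 2 (1\<^sub>m 2 + complex_of_real s \<cdot>\<^sub>m B i))"
    and q: "(\<Sum>i\<in>{1, 2, 3}. (q i)\<^sup>2) = (\<Sum>j\<in>{1, 2, 3}. (L j)\<^sup>2)"
    using pauli_map_basis_image[OF F frame_pauli_basis[OF f]] by blast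
  define k where "k i = (if i = 0 then c else s)" for i :: nat
  let ?I = "{..<2} \<times> {..<2} :: (nat \<times> nat) set"
  have sum_I: "(\<Sum>r\<in>?I. g r) = (\<Sum>i<2. \<Sum>j<2. g (i, j))" for g :: "nat \<times> nat \<Rightarrow> complex"
    unfolding sum.cartesian_product by (intro sum.cong) auto
  \<comment> \<open>The pair \<open>r\<close> runs over the Schmidt indices of ket and bra.\<close>
  have rho: "mat (2 * 2) (2 * 2) (\<lambda>(x, y). v x * cnj (v y)) =
      msum (2 * 2) (\<lambda>r. complex_of_real (k (fst r) * k (snd r)) \<cdot>\<^sub>m
        mat_tensor (dyad (e (fst r)) (e (snd r))) (dyad (f (fst r)) (f (snd r)))) ?I" (is "?rho = ?sum")
  proof (rule eq_matI)
    fix x y assume "x < dim_row ?sum" "y < dim_col ?sum"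
    then have xy: "x < 2 * 2" "y < 2 * 2" by (simp_all add: msum_def)
    note m = div_mod_less_mult[OF xy(1)] div_mod_less_mult[OF xy(2)]
    have v: "v x = (\<Sum>i<2. complex_of_real (k i) * e i (x div 2) * f i (x mod 2))" if "x < 2 * 2" for x
      using schmidt[OF div_mod_less_mult[OF that]] by (simp add: k_def sum_lessThan_2)
    show "?rho $$ (x, y) = ?sum $$ (x, y)"
      using xy m
      by (simp add: v msum_def mat_tensor_def dyad_def sum_I sum_lessThan_2 algebra_simps)
  qed (simp_all add: msum_def)
  have image: "map_tensor 2 2 F F ?rho =
      msum (2 * 2) (\<lambda>r. complex_of_real (k (fst r) * k (snd r)) \<cdot>\<^sub>m
        mat_tensor (F (dyad (e (fst r)) (e (snd r)))) (F (dyad (f (fst r)) (f (snd r))))) ?I"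
    unfolding rho by (rule map_tensor_tensor_sum[OF lin lin]) (simp_all add: dyad_def)
  define S t r where "S = 2 * c * s" and "t = c\<^sup>2 + s\<^sup>2" and "r = c\<^sup>2 - s\<^sup>2"
  \<comment> \<open>Over the four signs, (1 + xA) \<otimes> (1 + yB) weighted by 1 + xy sums to 4 (1
    \<otimes> 1 + A \<otimes> B), and weighted by 1 - xy to 4 (1 \<otimes> 1 - A \<otimes> B). The
    surplus of 1 \<otimes> 1 created for \<open>i = 1\<close> and \<open>i = 2\<close> is taken off
    the weights for \<open>i = 3\<close>.\<close>
  define w where "w = (\<lambda>(i::nat, x::real, y::real).
    if i = 1 then S * (p 1 * q 1) * (1 + x * y)
    else if i = 2 then S * (p 2 * q 2) * (1 - x * y)
    else t * (1 + (x * p 3) * (y * q 3)) + r * (x * p 3 + y * q 3) - S * (p 1 * q 1 + p 2 * q 2))"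
  define T where "T = (\<lambda>(i::nat, x::real, y::real).
    mat_tensor (1\<^sub>m 2 + complex_of_real x \<cdot>\<^sub>m A i) (1\<^sub>m 2 + complex_of_real y \<cdot>\<^sub>m B i))"
  let ?K = "{1, 2, 3} \<times> {1, - 1} \<times> {1, - 1} :: (nat \<times> real \<times> real) set"
  have w: "0 \<le> w z" if "z \<in> ?K" for z
  proof -
    obtain i x y where z: "z = (i, x, y)" by (cases z)
    have "x = 1 \<or> x = - 1" "y = 1 \<or> y = - 1" using that by (auto simp: z)
    then have xy: "x\<^sup>2 = 1" "y\<^sup>2 = 1" "\<bar>x * y\<bar> \<le> 1" by auto
    have "0 \<le> p 1" "0 \<le> p 2" "0 \<le> q 1" "0 \<le> q 2" using A B by blast+
    then have pq: "0 \<le> p 1 * q 1" "0 \<le> p 2 * q 2" "0 \<le> S" using cs by (simp_all add: S_def)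
    \<comment> \<open>The signs go into the third components, where squaring removes them; thus one
      inequality covers all four sign patterns.\<close>
    have "(p 1)\<^sup>2 + (p 2)\<^sup>2 + (x * p 3)\<^sup>2 \<le> 1" "(q 1)\<^sup>2 + (q 2)\<^sup>2 + (y * q 3)\<^sup>2 \<le> 1"
      using p q L xy(1,2) by (simp_all add: power_mult_distrib)
    from schmidt_weights_nonneg[OF this, of c s]
    have "0 \<le> t * (1 + (x * p 3) * (y * q 3)) + r * (x * p 3 + y * q 3) - S * (p 1 * q 1 + p 2 * q 2)"
      by (simp add: t_def r_def S_def)
    moreover have "0 \<le> 1 + x * y" "0 \<le> 1 - x * y" using xy(3) by linarith+
    ultimately show ?thesis using pq by (simp add: z w_def)
  qed
  have "map_tensor 2 2 F F ?rho = msum (2 * 2) (\<lambda>z. complex_of_real (w z / 16) \<cdot>\<^sub>m T z) ?K" (is "_ = ?dec")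
  proof (rule eq_matI)
    fix x y assume "x < dim_row ?dec" "y < dim_col ?dec"
    then have xy: "x < 2 * 2" "y < 2 * 2" by (simp_all add: msum_def)
    note m = div_mod_less_mult[OF xy(1)] div_mod_less_mult[OF xy(2)]
    have FC: "F (dyad g h) \<in> carrier_mat 2 2" for g h
      by (rule linear_on_mats_carrier[OF lin]) (simp add: dyad_def)
    have A': "\<forall>i\<in>{1, 2, 3}. A i \<in> carrier_mat 2 2 \<and> F (frame_pauli e i) = complex_of_real (p i) \<cdot>\<^sub>m A i"
      and B': "\<forall>i\<in>{1, 2, 3}. B i \<in> carrier_mat 2 2 \<and> F (frame_pauli f i) = complex_of_real (q i) \<cdot>\<^sub>m B i"
      using A B by blast+
    note EA = pauli_map_dyad_image[OF F e A' m(1,3)] and EB = pauli_map_dyad_image[OF F f B' m(2,4)]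
    define I I' where "I = (1\<^sub>m 2 :: complex mat) $$ (x div 2, y div 2)"
      and "I' = (1\<^sub>m 2 :: complex mat) $$ (x mod 2, y mod 2)"
    define a b where "a i = A i $$ (x div 2, y div 2)" and "b i = B i $$ (x mod 2, y mod 2)" for i
    let ?c = "complex_of_real"
    let ?target = "(?c t * (I * I' + ?c (p 3 * q 3) * (a 3 * b 3)) + ?c r * (?c (p 3) * (a 3 * I') + ?c (q 3) * (I * b 3)) +
      ?c S * (?c (p 1 * q 1) * (a 1 * b 1) - ?c (p 2 * q 2) * (a 2 * b 2))) / 4"
    have "map_tensor 2 2 F F ?rho $$ (x, y) =
        (\<Sum>i<2. \<Sum>j<2. ?c (k i * k j) * (F (dyad (e i) (e j)) $$ (x div 2, y div 2) * F (dyad (f i) (f j)) $$ (x mod 2, y mod 2)))"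
      unfolding image using xy mat_tensor_entry[OF FC FC xy] carrier_matD[OF FC]
      by (simp add: msum_def sum_I)
    \<comment> \<open>The two off-diagonal dyads contribute conjugate signs of \<open>\<i>\<close>:
      their mixed terms cancel, and \<open>\<i>\<close> squared produces the minus sign before the
      last term.\<close>
    also have "\<dots> = ?target"
      unfolding sum_lessThan_2 EA[unfolded One_nat_def] EB[unfolded One_nat_def]
        EA EB I_def[symmetric] I'_def[symmetric] a_def[symmetric] b_def[symmetric]
      by (simp add: k_def S_def t_def r_def power2_eq_square field_simps)
    also have "?target = (\<Sum>i\<in>{1, 2, 3}. \<Sum>g\<in>{1, - 1}. \<Sum>h\<in>{1, - 1}. ?c (w (i, g, h) / 16) * ((I + ?c g * a i) * (I' + ?c h * b i)))"
      by (simp add: w_def field_simps)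
    also have "\<dots> = (\<Sum>(i, g, h)\<in>?K. ?c (w (i, g, h) / 16) * ((I + ?c g * a i) * (I' + ?c h * b i)))"
      unfolding sum.cartesian_product by (simp add: case_prod_unfold)
    also have "\<dots> = ?dec $$ (x, y)"
    proof -
      have "?dec $$ (x, y) = (\<Sum>z\<in>?K. (?c (w z / 16) \<cdot>\<^sub>m T z) $$ (x, y))"
        using xy by (simp add: msum_def)
      also have "\<dots> = (\<Sum>(i, g, h)\<in>?K. ?c (w (i, g, h) / 16) * ((I + ?c g * a i) * (I' + ?c h * b i)))"
      proof (rule sum.cong[OF refl])
        fix z assume "z \<in> ?K"
        moreover obtain i g h where z1: "z = (i, g, h)" by (cases z)
        ultimately have z: "z = (i, g, h)" "i \<in> {1, 2, 3}" by (simp_all only: mem_Sigma_iff)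
        then have C: "A i \<in> carrier_mat 2 2" "B i \<in> carrier_mat 2 2" using A B by blast+
        have "T z $$ (x, y) = (I + ?c g * a i) * (I' + ?c h * b i)"
          using C xy m unfolding z(1) T_def prod.case
          by (subst mat_tensor_entry[of _ 2 _ 2]) (simp_all add: I_def I'_def a_def b_def)
        moreover have "T z \<in> carrier_mat (2 * 2) (2 * 2)"
          using C unfolding z(1) T_def prod.case by (intro mat_tensor_carrier) auto
        ultimately show "(?c (w z / 16) \<cdot>\<^sub>m T z) $$ (x, y) =
            (case z of (i, g, h) \<Rightarrow> ?c (w (i, g, h) / 16) * ((I + ?c g * a i) * (I' + ?c h * b i)))"
          using xy by (simp add: z(1))
      qed
      finally show ?thesis ..
    qed
    finally show "map_tensor 2 2 F F ?rho $$ (x, y) = ?dec $$ (x, y)" .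
  qed (simp_all add: msum_def map_tensor_def)
  moreover have "?dec \<in> sep_cone 2 2"
  proof (rule sep_cone_msum)
    fix z assume z: "z \<in> ?K"
    obtain i x y where z': "z = (i, x, y)" by (cases z)
    have i: "i \<in> {1, 2, 3}" and xy: "x\<^sup>2 = 1" "y\<^sup>2 = 1" using z by (auto simp: z')
    have "pos_semidef 2 (1\<^sub>m 2 + complex_of_real x \<cdot>\<^sub>m A i)" "pos_semidef 2 (1\<^sub>m 2 + complex_of_real y \<cdot>\<^sub>m B i)"
      using A B i xy by blast+
    then have "T z \<in> sep_cone 2 2"
      unfolding z' T_def prod.case by (rule sep_cone_tensor)
    then show "complex_of_real (w z / 16) \<cdot>\<^sub>m T z \<in> sep_cone 2 2"
      using w[OF z] by (intro sep_cone_smult) auto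
  qed simp
  ultimately show ?thesis by simp
qed

text \<open>A state is a sum of unnormalised pure states, the cone is closed under sums, and trace
  preservation restores the normalisation.\<close>

lemma pauli_map_two_LEA:
  assumes F: "pauli_map F \<sigma> L" "trace_preserving 2 F" and L: "(\<Sum>j\<in>{1, 2, 3}. (L j)\<^sup>2) \<le> 1"
  shows "two_LEA F"
  unfolding two_LEA_def entanglement_annihilating_def
proof (intro allI impI)
  fix \<rho> assume \<rho>: "is_state (2 * 2) \<rho>"
  have lin: "linear_on_mats 2 F" using F by (simp add: pauli_map_def)
  have psd: "pos_semidef (2 * 2) \<rho>" using \<rho> by (simp add: is_state_def)
  obtain v :: "nat \<Rightarrow> nat \<Rightarrow> complex"
    where v: "\<And>a b. a < 2 * 2 \<Longrightarrow> b < 2 * 2 \<Longrightarrow> \<rho> $$ (a, b) = (\<Sum>l<2 * 2. v l a * cnj (v l b))"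
    using pos_semidef_rank_one_sum[OF psd] by blast
  have "\<rho> = msum (2 * 2) (\<lambda>l. mat (2 * 2) (2 * 2) (\<lambda>(x, y). v l x * cnj (v l y))) {..<2 * 2}"
    using pos_semidef_carrier[OF psd] by (intro eq_matI) (simp_all add: msum_def v)
  then have \<rho>_eq: "map_tensor 2 2 F F \<rho> =
      msum (2 * 2) (\<lambda>l. map_tensor 2 2 F F (mat (2 * 2) (2 * 2) (\<lambda>(x, y). v l x * cnj (v l y)))) {..<2 * 2}"
    using map_tensor_msum[OF lin lin] by simp
  have "map_tensor 2 2 F F \<rho> \<in> sep_cone 2 2"
    unfolding \<rho>_eq by (intro sep_cone_msum pauli_map_pure_sep_cone[OF F(1) L]) simp
  moreover have "mat_trace (map_tensor 2 2 F F \<rho>) = 1"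
    using \<rho> map_tensor_trace[OF lin F(2) lin F(2) pos_semidef_carrier[OF psd]] by (simp add: is_state_def)
  ultimately show "separable 2 2 (map_tensor 2 2 F F \<rho>)"
    by (rule sep_cone_separable)
qed

theorem proposition2:
  fixes E :: "complex mat \<Rightarrow> complex mat"
    and l1 l2 l3 :: real
  assumes "is_channel 2 E"
    and "unital 2 E"
    and "pauli_diagonal E l1 l2 l3"
  shows "(two_LEA E \<longleftrightarrow> entanglement_breaking 2 (E \<circ> E)) \<and>
         (entanglement_breaking 2 (E \<circ> E) \<longleftrightarrow> l1\<^sup>2 + l2\<^sup>2 + l3\<^sup>2 \<le> 1)"
proof -
  have lin: "linear_on_mats 2 E" and tp: "trace_preserving 2 E"
    using assms(1) by (auto simp: is_channel_def)
  obtain \<sigma> where \<sigma>: "pauli_basis \<sigma>" and E: "E (1\<^sub>m 2) = 1\<^sub>m 2"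
    "E (\<sigma> 1) = complex_of_real l1 \<cdot>\<^sub>m \<sigma> 1" "E (\<sigma> 2) = complex_of_real l2 \<cdot>\<^sub>m \<sigma> 2"
    "E (\<sigma> 3) = complex_of_real l3 \<cdot>\<^sub>m \<sigma> 3"
    using assms(3) unfolding pauli_diagonal_def by blast
  define L :: "nat \<Rightarrow> real" where "L j = (if j = 0 then 1 else if j = 1 then l1 else if j = 2 then l2 else l3)" for j
  have "E (\<sigma> j) = complex_of_real (L j) \<cdot>\<^sub>m \<sigma> j" if "j < 4" for j
  proof -
    have "\<sigma> 0 = 1\<^sub>m 2" using \<sigma> by (simp add: pauli_basis_def)
    moreover have "complex_of_real 1 \<cdot>\<^sub>m 1\<^sub>m 2 = (1\<^sub>m 2 :: complex mat)" by auto
    moreover have "j = 0 \<or> j = 1 \<or> j = 2 \<or> j = 3" using that by auto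
    ultimately show ?thesis using E by (elim disjE) (simp_all add: L_def)
  qed
  then have pm: "pauli_map E \<sigma> L"
    using lin \<sigma> by (simp add: pauli_map_def L_def)
  \<comment> \<open>The square of the channel is diagonal in the same basis, with the nonnegative
    entries \<lambda>_j^2 that the measure-and-prepare construction asks for.\<close>
  note pm2 = pauli_map_comp[OF pm pm]
  have tp2: "trace_preserving 2 (E \<circ> E)"
    using tp lin by (simp add: trace_preserving_def linear_on_mats_def)
  have sum: "L 1 * L 1 + L 2 * L 2 + L 3 * L 3 = l1\<^sup>2 + l2\<^sup>2 + l3\<^sup>2"
    by (simp add: L_def power2_eq_square)
  have "l1\<^sup>2 + l2\<^sup>2 + l3\<^sup>2 \<le> 1" if "two_LEA E"
    using pauli_map_separable_singlet[OF pm pm] that singlet_state sum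
    unfolding two_LEA_def entanglement_annihilating_def by simp
  \<comment> \<open>A qubit ancilla is taken, and the identity on it counts as the diagonal map with
    all entries 1.\<close>
  moreover have "l1\<^sup>2 + l2\<^sup>2 + l3\<^sup>2 \<le> 1" if "entanglement_breaking 2 (E \<circ> E)"
    using pauli_map_separable_singlet[OF pm2 pauli_map_id[OF \<sigma>]] that singlet_state sum
    unfolding entanglement_breaking_def by simp
  moreover have "two_LEA E" if "l1\<^sup>2 + l2\<^sup>2 + l3\<^sup>2 \<le> 1"
    using that by (intro pauli_map_two_LEA[OF pm tp]) (simp add: L_def)
  moreover have "entanglement_breaking 2 (E \<circ> E)" if "l1\<^sup>2 + l2\<^sup>2 + l3\<^sup>2 \<le> 1"
    using that sum by (intro pauli_map_entanglement_breaking[OF pm2 tp2]) auto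
  ultimately show ?thesis by blast
qed

end
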